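(* Let $G$ be a finite group and $M$ a covariant coefficient system for $G$. Let $X$ be a $G$-space of the ($G$-)homotopy type of a $G$-CW-complex. Assume that the fixed point space $X^H$ is connected (possibly empty) for each subgroup $H\subset G$. Let $\mathcal H$ be the family of all subgroups $H\subset G$ such that $X^H\neq\emptyset$. Then the Bredon-Illman equivariant homology group $H^G_0(X;M)$ is a quotient of $\bigoplus_{H\in\mathcal H}M(G/H)$. Furthermore, if $X$ has a $G$-fixed point, then $H^G_0(X;M)\cong M(G/G)$.
   Context: Pointed $G$-spaces and pointed $G$-sets have a $G$-fixed base point $x_0$; $G_x$ is the isotropy group of $x$. Spaces are k-spaces ($X$ is a k-space if $W\subset X$ is closed whenever $f^{-1}(W)$ is closed for every continuous $f:Z\to X$, $Z$ compact Hausdorff). A covariant coefficient system is a covariant functor $M$ from the orbit category $\mathcal O(G)$ (objects $G/H$; morphisms $G$-functions) to $R$-modules, $R$ a commutative ring; $M_*(\alpha)$ is the homomorphism induced by $\alpha$. For a pointed $G$-set $S$, $F(S,M)$ is the $R$-module of functions $u:S\to\bigcup_{H\subset G}M(G/H)$ with $u(x)\in M(G/G_x)$, $u(x_0)=0$ and $u(x)=0$ for all but finitely many $x$; $lx$ ($l\in M(G/G_x)$) is the function with value $l$ at $x$ and $0$ elsewhere ($lx_0=0$). $G$ acts by $g\cdot(lx)=M_*(R_{g^{-1}})(l)(gx)$, where $R_{g^{-1}}:G/G_x\to G/G_{gx}$, $aG_x\mapsto ag^{-1}G_{gx}$. The fixed submodule $F(S,M)^G$ is generated by the elements $\gamma^G_x(l)=\sum_{[g]\in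 G/G_x}M_*(R_{g^{-1}})(l)(gx)$. $F^G(S,M)$ denotes $F(S,M)^G$ made functorial in pointed $G$-functions $f:S\to T$ by $f^G_*(\gamma^G_x(l))=\gamma^G_{f(x)}(M_*(\widehat f_x)(l))$, with $\widehat f_x:G/G_x\to G/G_{f(x)}$ the canonical projection. For a pointed $G$-space $Y$ let $\mathcal S(Y)$ be its singular simplicial pointed $G$-set ($\mathcal S_q(Y)$ = continuous maps $\Delta^q\to Y$, based at the constant simplex). $\widetilde H^G_q(Y;M)$ is the $q$th homology of the chain complex $F^G(\mathcal S_q(Y),M)$ with differential $\sum_{i=0}^q(-1)^i(d_i)^G_*$ (this complex is isomorphic to Illman's equivariant singular chain complex of $Y$ relative to its base point). For an unpointed $G$-space $X$, $H^G_q(X;M)=\widetilde H^G_q(X^+;M)$, where $X^+$ is $X$ with a disjoint $G$-fixed base point added. *)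

theory Defs
  imports "HOL-Algebra.Group_Action" "HOL-Algebra.Left_Coset" "HOL-Algebra.Module" "HOL-Homology.Homology"
begin

section \<open>Modules\<close>

definition lin_maps ::
  "('r, 'p) ring_scheme \<Rightarrow> ('r, 'a, 'q) module_scheme \<Rightarrow> ('r, 'b, 's) module_scheme \<Rightarrow> ('a \<Rightarrow> 'b) set"
  where "lin_maps R A B =
    {h \<in> carrier A \<rightarrow> carrier B.
       (\<forall>x\<in>carrier A. \<forall>y\<in>carrier A. h (x \<oplus>\<^bsub>A\<^esub> y) = h x \<oplus>\<^bsub>B\<^esub> h y) \<and>
       (\<forall>r\<in>carrier R. \<forall>x\<in>carrier A. h (r \<odot>\<^bsub>A\<^esub> x) = r \<odot>\<^bsub>B\<^esub> h x)}"

definition module_iso ::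
  "('r, 'p) ring_scheme \<Rightarrow> ('r, 'a, 'q) module_scheme \<Rightarrow> ('r, 'b, 's) module_scheme \<Rightarrow> bool"
  where "module_iso R A B \<longleftrightarrow> (\<exists>h\<in>lin_maps R A B. bij_betw h (carrier A) (carrier B))"

text \<open>The type of modules extends the type of rings; the multiplicative fields of the modules
  below are never used and are left unspecified.\<close>

definition quot_module :: "('r, 'a, 'q) module_scheme \<Rightarrow> 'a set \<Rightarrow> ('r, 'a set) module"
  where "quot_module A N =
    \<lparr>carrier = a_rcosets\<^bsub>A\<^esub> N, monoid.mult = undefined, one = undefined,
     ring.zero = N, add = set_add A,
     smult = (\<lambda>r C. \<Union>c\<in>C. N +>\<^bsub>A\<^esub> (r \<odot>\<^bsub>A\<^esub> c))\<rparr>"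

definition is_quotient_of ::
  "('r, 'p) ring_scheme \<Rightarrow> ('r, 'b, 's) module_scheme \<Rightarrow> ('r, 'a, 'q) module_scheme \<Rightarrow> bool"
  where "is_quotient_of R B A \<longleftrightarrow>
    (\<exists>N. submodule N R A \<and> module_iso R (quot_module A N) B)"

definition direct_sum :: "'i set \<Rightarrow> ('i \<Rightarrow> ('r, 'a) module) \<Rightarrow> ('r, 'i \<Rightarrow> 'a) module"
  where "direct_sum I A =
    \<lparr>carrier = {f \<in> Pi\<^sub>E I (\<lambda>i. carrier (A i)). finite {i \<in> I. f i \<noteq> \<zero>\<^bsub>A i\<^esub>}},
     monoid.mult = undefined, one = undefined,
     ring.zero = (\<lambda>i\<in>I. \<zero>\<^bsub>A i\<^esub>),
     add = (\<lambda>f g. \<lambda>i\<in>I. f i \<oplus>\<^bsub>A i\<^esub> g i),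
     smult = (\<lambda>r f. \<lambda>i\<in>I. r \<odot>\<^bsub>A i\<^esub> f i)\<rparr>"


section \<open>The orbit category and coefficient systems\<close>

text \<open>The orbit \<open>G/H\<close> is the set \<open>lcosets\<^bsub>G\<^esub> H\<close>; since it determines \<open>H\<close>, the objects of the
  orbit category are represented by the subgroups.  Morphisms are extensional functions.\<close>

definition orbit_hom :: "('g, 'c) monoid_scheme \<Rightarrow> 'g set \<Rightarrow> 'g set \<Rightarrow> ('g set \<Rightarrow> 'g set) set"
  where "orbit_hom G H K =
    {\<alpha> \<in> (lcosets\<^bsub>G\<^esub> H) \<rightarrow>\<^sub>E (lcosets\<^bsub>G\<^esub> K).
       \<forall>g\<in>carrier G. \<forall>C\<in>lcosets\<^bsub>G\<^esub> H. \<alpha> (g <#\<^bsub>G\<^esub> C) = g <#\<^bsub>G\<^esub> \<alpha> C}"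

text \<open>If \<open>H \<subseteq> bKb\<^sup>-\<^sup>1\<close>, then \<open>aH\<cdot>bK = abK\<close>, so this is the \<open>G\<close>-function
  \<open>G/H \<rightarrow> G/K\<close>, \<open>aH \<mapsto> abK\<close>.\<close>

definition orbit_map :: "('g, 'c) monoid_scheme \<Rightarrow> 'g set \<Rightarrow> 'g set \<Rightarrow> 'g \<Rightarrow> 'g set \<Rightarrow> 'g set"
  where "orbit_map G H K b = (\<lambda>C\<in>lcosets\<^bsub>G\<^esub> H. C <#>\<^bsub>G\<^esub> (b <#\<^bsub>G\<^esub> K))"

text \<open>\<open>obj M H\<close> is the module \<open>M(G/H)\<close>, and \<open>mor M H K \<alpha>\<close> is the homomorphism induced by
  \<open>\<alpha> : G/H \<rightarrow> G/K\<close>.\<close>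

record ('g, 'r, 'm) coeff =
  obj :: "'g set \<Rightarrow> ('r, 'm) module"
  mor :: "'g set \<Rightarrow> 'g set \<Rightarrow> ('g set \<Rightarrow> 'g set) \<Rightarrow> 'm \<Rightarrow> 'm"

definition coefficient_system ::
  "('g, 'c) monoid_scheme \<Rightarrow> ('r, 'p) ring_scheme \<Rightarrow> ('g, 'r, 'm) coeff \<Rightarrow> bool"
  where "coefficient_system G R M \<longleftrightarrow>
    (\<forall>H. subgroup H G \<longrightarrow> Module.module R (obj M H)) \<and>
    (\<forall>H K \<alpha>. subgroup H G \<and> subgroup K G \<and> \<alpha> \<in> orbit_hom G H K \<longrightarrow>
       mor M H K \<alpha> \<in> lin_maps R (obj M H) (obj M K)) \<and>
    (\<forall>H. subgroup H G \<longrightarrow>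
       (\<forall>l\<in>carrier (obj M H). mor M H H (\<lambda>C\<in>lcosets\<^bsub>G\<^esub> H. C) l = l)) \<and>
    (\<forall>H K L \<alpha> \<beta>. subgroup H G \<and> subgroup K G \<and> subgroup L G \<and>
         \<alpha> \<in> orbit_hom G H K \<and> \<beta> \<in> orbit_hom G K L \<longrightarrow>
       (\<forall>l\<in>carrier (obj M H).
          mor M H L (compose (lcosets\<^bsub>G\<^esub> H) \<beta> \<alpha>) l = mor M K L \<beta> (mor M H K \<alpha> l)))"


section \<open>The functor \<open>F\<^sup>G(-, M)\<close>\<close>

text \<open>A pointed \<open>G\<close>-set is given by its carrier \<open>S\<close>, action \<open>\<psi>\<close> and base point \<open>s0\<close>.\<close>

definition F_mod ::
  "('g, 'c) monoid_scheme \<Rightarrow> ('g, 'r, 'm) coeff \<Rightarrow> 's set \<Rightarrow> ('g \<Rightarrow> 's \<Rightarrow> 's) \<Rightarrow> 's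
    \<Rightarrow> ('r, 's \<Rightarrow> 'm) module"
  where "F_mod G M S \<psi> s0 =
    (let V = (\<lambda>x. obj M (stabilizer G \<psi> x)) in
     \<lparr>carrier = {u \<in> Pi\<^sub>E S (\<lambda>x. carrier (V x)).
        u s0 = \<zero>\<^bsub>V s0\<^esub> \<and> finite {x \<in> S. u x \<noteq> \<zero>\<^bsub>V x\<^esub>}},
      monoid.mult = undefined, one = undefined,
      ring.zero = (\<lambda>x\<in>S. \<zero>\<^bsub>V x\<^esub>),
      add = (\<lambda>u v. \<lambda>x\<in>S. u x \<oplus>\<^bsub>V x\<^esub> v x),
      smult = (\<lambda>r u. \<lambda>x\<in>S. r \<odot>\<^bsub>V x\<^esub> u x)\<rparr>)"

text \<open>The element \<open>lx\<close>.\<close>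

definition F_single ::
  "('g, 'c) monoid_scheme \<Rightarrow> ('g, 'r, 'm) coeff \<Rightarrow> 's set \<Rightarrow> ('g \<Rightarrow> 's \<Rightarrow> 's) \<Rightarrow> 's
    \<Rightarrow> 'm \<Rightarrow> 's \<Rightarrow> 's \<Rightarrow> 'm"
  where "F_single G M S \<psi> s0 l x =
    (\<lambda>y\<in>S. if y = x \<and> x \<noteq> s0 then l else \<zero>\<^bsub>obj M (stabilizer G \<psi> y)\<^esub>)"

text \<open>\<open>M\<^sub>*(R\<^bsub>g\<^sup>-\<^sup>1\<^esub>) : M(G/G\<^sub>x) \<rightarrow> M(G/G\<^bsub>gx\<^esub>)\<close>, where \<open>R\<^bsub>g\<^sup>-\<^sup>1\<^esub>\<close> sends \<open>aG\<^sub>x\<close> to \<open>ag\<^sup>-\<^sup>1G\<^bsub>gx\<^esub>\<close>.\<close>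

definition R_star ::
  "('g, 'c) monoid_scheme \<Rightarrow> ('g, 'r, 'm) coeff \<Rightarrow> ('g \<Rightarrow> 's \<Rightarrow> 's) \<Rightarrow> 'g \<Rightarrow> 's \<Rightarrow> 'm \<Rightarrow> 'm"
  where "R_star G M \<psi> g x =
    (let H = stabilizer G \<psi> x; K = stabilizer G \<psi> (\<psi> g x)
     in mor M H K (orbit_map G H K (inv\<^bsub>G\<^esub> g)))"

text \<open>The \<open>G\<close>-action on \<open>F(S, M)\<close>: the additive extension of
  \<open>g\<cdot>(lx) = M\<^sub>*(R\<^bsub>g\<^sup>-\<^sup>1\<^esub>)(l)(gx)\<close>, evaluated at \<open>y = gx\<close>.\<close>

definition F_act ::
  "('g, 'c) monoid_scheme \<Rightarrow> ('g, 'r, 'm) coeff \<Rightarrow> 's set \<Rightarrow> ('g \<Rightarrow> 's \<Rightarrow> 's) \<Rightarrow> 'g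
    \<Rightarrow> ('s \<Rightarrow> 'm) \<Rightarrow> 's \<Rightarrow> 'm"
  where "F_act G M S \<psi> g u =
    (\<lambda>y\<in>S. R_star G M \<psi> g (\<psi> (inv\<^bsub>G\<^esub> g) y) (u (\<psi> (inv\<^bsub>G\<^esub> g) y)))"

definition FG_mod ::
  "('g, 'c) monoid_scheme \<Rightarrow> ('g, 'r, 'm) coeff \<Rightarrow> 's set \<Rightarrow> ('g \<Rightarrow> 's \<Rightarrow> 's) \<Rightarrow> 's
    \<Rightarrow> ('r, 's \<Rightarrow> 'm) module"
  where "FG_mod G M S \<psi> s0 = (F_mod G M S \<psi> s0)
    \<lparr>carrier := {u \<in> carrier (F_mod G M S \<psi> s0). \<forall>g\<in>carrier G. F_act G M S \<psi> g u = u}\<rparr>"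

text \<open>\<open>\<gamma>\<^sup>G\<^sub>x(l)\<close>; the summand does not depend on the representative \<open>g\<close> of the coset \<open>C\<close>.\<close>

definition F_gamma ::
  "('g, 'c) monoid_scheme \<Rightarrow> ('g, 'r, 'm) coeff \<Rightarrow> 's set \<Rightarrow> ('g \<Rightarrow> 's \<Rightarrow> 's) \<Rightarrow> 's
    \<Rightarrow> 's \<Rightarrow> 'm \<Rightarrow> 's \<Rightarrow> 'm"
  where "F_gamma G M S \<psi> s0 x l =
    (\<Oplus>\<^bsub>F_mod G M S \<psi> s0\<^esub> C \<in> lcosets\<^bsub>G\<^esub> (stabilizer G \<psi> x).
       (let g = (SOME g. g \<in> C) in F_single G M S \<psi> s0 (R_star G M \<psi> g x l) (\<psi> g x)))"

text \<open>The homomorphism \<open>f\<^sup>G\<^sub>*\<close> induced by a pointed \<open>G\<close>-function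
  \<open>f : (S, \<psi>, s0) \<rightarrow> (T, \<theta>, t0)\<close>.  The elements \<open>\<gamma>\<^sup>G\<^sub>x(l)\<close> generate
  \<open>F\<^sup>G(S, M)\<close>, so it is determined by its values on them.\<close>

definition FG_map ::
  "('g, 'c) monoid_scheme \<Rightarrow> ('r, 'p) ring_scheme \<Rightarrow> ('g, 'r, 'm) coeff
    \<Rightarrow> 's set \<Rightarrow> ('g \<Rightarrow> 's \<Rightarrow> 's) \<Rightarrow> 's \<Rightarrow> 't set \<Rightarrow> ('g \<Rightarrow> 't \<Rightarrow> 't) \<Rightarrow> 't
    \<Rightarrow> ('s \<Rightarrow> 't) \<Rightarrow> ('s \<Rightarrow> 'm) \<Rightarrow> ('t \<Rightarrow> 'm)"
  where "FG_map G R M S \<psi> s0 T \<theta> t0 f =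
    (THE h. h \<in> lin_maps R (FG_mod G M S \<psi> s0) (FG_mod G M T \<theta> t0) \<and>
       h \<in> extensional (carrier (FG_mod G M S \<psi> s0)) \<and>
       (\<forall>x\<in>S. \<forall>l\<in>carrier (obj M (stabilizer G \<psi> x)).
          h (F_gamma G M S \<psi> s0 x l) =
          F_gamma G M T \<theta> t0 (f x)
            (let H = stabilizer G \<psi> x; K = stabilizer G \<theta> (f x)
             in mor M H K (orbit_map G H K \<one>\<^bsub>G\<^esub>) l)))"


section \<open>\<open>G\<close>-spaces\<close>

text \<open>\<open>G\<close> is always finite and discrete here, so an action is continuous iff each of its
  translations is.\<close>

definition G_space :: "('g, 'c) monoid_scheme \<Rightarrow> 'x topology \<Rightarrow> ('g \<Rightarrow> 'x \<Rightarrow> 'x) \<Rightarrow> bool"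
  where "G_space G X \<phi> \<longleftrightarrow>
    group_action G (topspace X) \<phi> \<and> (\<forall>g\<in>carrier G. continuous_map X X (\<phi> g))"

definition fixed_points :: "'x topology \<Rightarrow> ('g \<Rightarrow> 'x \<Rightarrow> 'x) \<Rightarrow> 'g set \<Rightarrow> 'x set"
  where "fixed_points X \<phi> H = {x \<in> topspace X. \<forall>h\<in>H. \<phi> h x = x}"

text \<open>The k-space condition with test spaces carried by a type \<open>'z\<close>; a space is a k-space iff this
  holds for some \<open>'z\<close>.  Since test maps need not be injective and \<open>X\<close> need not be Hausdorff, this
  is more restrictive than \<open>k_space\<close> of HOL-Analysis.  A theorem that assumes it for an arbitrary
  \<open>'z\<close> thus covers all k-spaces; likewise, a free type for a \<open>G\<close>-CW-complex covers all of them.\<close>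

definition k_space_via :: "'z itself \<Rightarrow> 'x topology \<Rightarrow> bool"
  where "k_space_via TYPE('z) X \<longleftrightarrow>
    (\<forall>W \<subseteq> topspace X.
       (\<forall>(Z :: 'z topology) f.
          compact_space Z \<and> Hausdorff_space Z \<and> continuous_map Z X f \<longrightarrow>
          closedin Z {z \<in> topspace Z. f z \<in> W}) \<longrightarrow>
       closedin X W)"

definition equivariant ::
  "('g, 'c) monoid_scheme \<Rightarrow> 'x topology \<Rightarrow> ('g \<Rightarrow> 'x \<Rightarrow> 'x) \<Rightarrow> ('g \<Rightarrow> 'y \<Rightarrow> 'y) \<Rightarrow> ('x \<Rightarrow> 'y) \<Rightarrow> bool"
  where "equivariant G X \<phi> \<theta> f \<longleftrightarrow>
    (\<forall>g\<in>carrier G. \<forall>x\<in>topspace X. f (\<phi> g x) = \<theta> g (f x))"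

definition G_homotopy_equivalent ::
  "('g, 'c) monoid_scheme \<Rightarrow> 'x topology \<Rightarrow> ('g \<Rightarrow> 'x \<Rightarrow> 'x)
    \<Rightarrow> 'y topology \<Rightarrow> ('g \<Rightarrow> 'y \<Rightarrow> 'y) \<Rightarrow> bool"
  where "G_homotopy_equivalent G X \<phi> Y \<theta> \<longleftrightarrow>
    (\<exists>f h. continuous_map X Y f \<and> equivariant G X \<phi> \<theta> f \<and>
       continuous_map Y X h \<and> equivariant G Y \<theta> \<phi> h \<and>
       homotopic_with (equivariant G X \<phi> \<phi>) X X (h \<circ> f) id \<and>
       homotopic_with (equivariant G Y \<theta> \<theta>) Y Y (f \<circ> h) id)"


section \<open>\<open>G\<close>-CW-complexes\<close>

definition disc :: "nat \<Rightarrow> (nat \<Rightarrow> real) topology"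
  where "disc n = subtopology (Euclidean_space n) {v. (\<Sum>i<n. (v i)\<^sup>2) \<le> 1}"

definition disc_boundary :: "nat \<Rightarrow> (nat \<Rightarrow> real) set"
  where "disc_boundary n = {v \<in> topspace (disc n). (\<Sum>i<n. (v i)\<^sup>2) = 1}"

definition orbit_disc ::
  "('g, 'c) monoid_scheme \<Rightarrow> 'g set \<Rightarrow> nat \<Rightarrow> ('g set \<times> (nat \<Rightarrow> real)) topology"
  where "orbit_disc G H n = prod_topology (discrete_topology (lcosets\<^bsub>G\<^esub> H)) (disc n)"

text \<open>\<open>B\<close> is obtained from its subspace \<open>A\<close> by attaching \<open>n\<close>-cells \<open>G/H \<times> D\<^sup>n\<close> along \<open>G\<close>-maps
  \<open>G/H \<times> S\<^sup>n\<^sup>-\<^sup>1 \<rightarrow> A\<close>, i.e. \<open>B\<close> is the pushout of \<open>A\<close> and the coproduct of the cells.  A cell is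
  given by \<open>H\<close> and its characteristic map \<open>\<Phi> : G/H \<times> D\<^sup>n \<rightarrow> B\<close>; distinct cells have
  distinct characteristic maps, so no further index is needed.\<close>

definition attach_cells ::
  "('g, 'c) monoid_scheme \<Rightarrow> 'y topology \<Rightarrow> ('g \<Rightarrow> 'y \<Rightarrow> 'y) \<Rightarrow> nat \<Rightarrow> 'y set \<Rightarrow> 'y set
    \<Rightarrow> ('g set \<times> ('g set \<times> (nat \<Rightarrow> real) \<Rightarrow> 'y)) set \<Rightarrow> bool"
  where "attach_cells G Y \<theta> n A B cells \<longleftrightarrow>
    A \<subseteq> B \<and>
    (\<forall>(H, \<Phi>)\<in>cells.
       subgroup H G \<and>
       continuous_map (orbit_disc G H n) (subtopology Y B) \<Phi> \<and>
       (\<forall>g\<in>carrier G. \<forall>C\<in>lcosets\<^bsub>G\<^esub> H. \<forall>v\<in>topspace (disc n).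
          \<Phi> (g <#\<^bsub>G\<^esub> C, v) = \<theta> g (\<Phi> (C, v))) \<and>
       \<Phi> ` ((lcosets\<^bsub>G\<^esub> H) \<times> disc_boundary n) \<subseteq> A) \<and>
    bij_betw (\<lambda>((H, \<Phi>), z). \<Phi> z)
      (Sigma cells (\<lambda>(H, \<Phi>). (lcosets\<^bsub>G\<^esub> H) \<times> (topspace (disc n) - disc_boundary n)))
      (B - A) \<and>
    (\<forall>W \<subseteq> B.
       closedin (subtopology Y A) (W \<inter> A) \<and>
       (\<forall>(H, \<Phi>)\<in>cells. closedin (orbit_disc G H n) {z \<in> topspace (orbit_disc G H n). \<Phi> z \<in> W}) \<longrightarrow>
       closedin (subtopology Y B) W)"

definition G_CW_complex :: "('g, 'c) monoid_scheme \<Rightarrow> 'y topology \<Rightarrow> ('g \<Rightarrow> 'y \<Rightarrow> 'y) \<Rightarrow> bool"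
  where "G_CW_complex G Y \<theta> \<longleftrightarrow>
    G_space G Y \<theta> \<and>
    (\<exists>(sk :: nat \<Rightarrow> 'y set) cells.
       (\<Union>n. sk n) = topspace Y \<and>
       (\<forall>n. attach_cells G Y \<theta> n (if n = 0 then {} else sk (n - 1)) (sk n) (cells n)) \<and>
       (\<forall>W \<subseteq> topspace Y. (\<forall>n. closedin (subtopology Y (sk n)) (W \<inter> sk n)) \<longrightarrow> closedin Y W))"


section \<open>Bredon-Illman homology\<close>

definition sing_act ::
  "nat \<Rightarrow> 'y topology \<Rightarrow> ('g \<Rightarrow> 'y \<Rightarrow> 'y) \<Rightarrow> 'g \<Rightarrow> ((nat \<Rightarrow> real) \<Rightarrow> 'y) \<Rightarrow> (nat \<Rightarrow> real) \<Rightarrow> 'y"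
  where "sing_act q Y \<phi> g =
    (\<lambda>\<sigma>\<in>singular_simplex_set q Y. \<lambda>v\<in>standard_simplex q. \<phi> g (\<sigma> v))"

definition const_simplex :: "nat \<Rightarrow> 'y \<Rightarrow> (nat \<Rightarrow> real) \<Rightarrow> 'y"
  where "const_simplex q y0 = (\<lambda>v\<in>standard_simplex q. y0)"

definition chains ::
  "('g, 'c) monoid_scheme \<Rightarrow> ('g, 'r, 'm) coeff \<Rightarrow> 'y topology \<Rightarrow> ('g \<Rightarrow> 'y \<Rightarrow> 'y) \<Rightarrow> 'y \<Rightarrow> nat
    \<Rightarrow> ('r, ((nat \<Rightarrow> real) \<Rightarrow> 'y) \<Rightarrow> 'm) module"
  where "chains G M Y \<phi> y0 q =
    FG_mod G M (singular_simplex_set q Y) (sing_act q Y \<phi>) (const_simplex q y0)"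

text \<open>The differential from degree \<open>q\<close> to degree \<open>q - 1\<close>, for \<open>q \<ge> 1\<close>.\<close>

definition differential ::
  "('g, 'c) monoid_scheme \<Rightarrow> ('r, 'p) ring_scheme \<Rightarrow> ('g, 'r, 'm) coeff
    \<Rightarrow> 'y topology \<Rightarrow> ('g \<Rightarrow> 'y \<Rightarrow> 'y) \<Rightarrow> 'y \<Rightarrow> nat
    \<Rightarrow> (((nat \<Rightarrow> real) \<Rightarrow> 'y) \<Rightarrow> 'm) \<Rightarrow> ((nat \<Rightarrow> real) \<Rightarrow> 'y) \<Rightarrow> 'm"
  where "differential G R M Y \<phi> y0 q c =
    (\<Oplus>\<^bsub>chains G M Y \<phi> y0 (q - 1)\<^esub> i \<in> {..q}.
       ((\<ominus>\<^bsub>R\<^esub> \<one>\<^bsub>R\<^esub>) [^]\<^bsub>R\<^esub> i) \<odot>\<^bsub>chains G M Y \<phi> y0 (q - 1)\<^esub>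
       FG_map G R M
         (singular_simplex_set q Y) (sing_act q Y \<phi>) (const_simplex q y0)
         (singular_simplex_set (q - 1) Y) (sing_act (q - 1) Y \<phi>) (const_simplex (q - 1) y0)
         (singular_face q i) c)"

definition cycles ::
  "('g, 'c) monoid_scheme \<Rightarrow> ('r, 'p) ring_scheme \<Rightarrow> ('g, 'r, 'm) coeff
    \<Rightarrow> 'y topology \<Rightarrow> ('g \<Rightarrow> 'y \<Rightarrow> 'y) \<Rightarrow> 'y \<Rightarrow> nat
    \<Rightarrow> ('r, ((nat \<Rightarrow> real) \<Rightarrow> 'y) \<Rightarrow> 'm) module"
  where "cycles G R M Y \<phi> y0 q = (chains G M Y \<phi> y0 q)
    \<lparr>carrier := {c \<in> carrier (chains G M Y \<phi> y0 q).
       q = 0 \<or> differential G R M Y \<phi> y0 q c = \<zero>\<^bsub>chains G M Y \<phi> y0 (q - 1)\<^esub>}\<rparr>"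

definition reduced_homology ::
  "('g, 'c) monoid_scheme \<Rightarrow> ('r, 'p) ring_scheme \<Rightarrow> ('g, 'r, 'm) coeff
    \<Rightarrow> 'y topology \<Rightarrow> ('g \<Rightarrow> 'y \<Rightarrow> 'y) \<Rightarrow> 'y \<Rightarrow> nat
    \<Rightarrow> ('r, (((nat \<Rightarrow> real) \<Rightarrow> 'y) \<Rightarrow> 'm) set) module"
  where "reduced_homology G R M Y \<phi> y0 q =
    quot_module (cycles G R M Y \<phi> y0 q)
      (differential G R M Y \<phi> y0 (Suc q) ` carrier (chains G M Y \<phi> y0 (Suc q)))"

text \<open>\<open>X\<^sup>+\<close>, with added base point \<^const>\<open>None\<close>.\<close>

definition plus_space :: "'x topology \<Rightarrow> 'x option topology"
  where "plus_space X =
    topology (\<lambda>U. U \<subseteq> insert None (Some ` topspace X) \<and> openin X {x. Some x \<in> U})"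

definition plus_act :: "'x topology \<Rightarrow> ('g \<Rightarrow> 'x \<Rightarrow> 'x) \<Rightarrow> 'g \<Rightarrow> 'x option \<Rightarrow> 'x option"
  where "plus_act X \<phi> g = (\<lambda>y\<in>insert None (Some ` topspace X). map_option (\<phi> g) y)"

definition homology ::
  "('g, 'c) monoid_scheme \<Rightarrow> ('r, 'p) ring_scheme \<Rightarrow> ('g, 'r, 'm) coeff
    \<Rightarrow> 'x topology \<Rightarrow> ('g \<Rightarrow> 'x \<Rightarrow> 'x) \<Rightarrow> nat
    \<Rightarrow> ('r, (((nat \<Rightarrow> real) \<Rightarrow> 'x option) \<Rightarrow> 'm) set) module"
  where "homology G R M X \<phi> q = reduced_homology G R M (plus_space X) (plus_act X \<phi>) None q"

end

theory Submission
  imports Defs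
begin

text \<open>In a \<open>G\<close>-CW-complex \<open>Y\<close> the path components of \<open>Y\<^sup>H\<close> are unions of cells, and any union of
  them is closed; hence a connected \<open>X\<^sup>H\<close> is path connected.  A path in \<open>X\<^sup>K\<close>, where \<open>K = G\<^sub>x\<close>, that
  joins \<open>x\<close> to \<open>y\<close> is a singular 1-simplex with isotropy group \<open>K\<close>, so for \<open>l \<in> M(G/K)\<close> the class of
  \<open>\<gamma>\<^sub>x(l)\<close> in degree \<open>0\<close> equals that of \<open>\<gamma>\<^sub>y\<close> applied to the image of \<open>l\<close> in \<open>M(G/G\<^sub>y)\<close>.  Choosing one
  point of \<open>X\<^sup>H\<close> for every \<open>H\<close> therefore gives a surjection from the direct sum.  If \<open>x\<^sub>0\<close> is
  a \<open>G\<close>-fixed point, every class comes from \<open>x\<^sub>0\<close>, and the augmentation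
  \<open>\<gamma>\<^sub>x(l) \<mapsto> M(G/G\<^sub>x \<rightarrow> G/G)(l)\<close> is inverse to \<open>l \<mapsto> [\<gamma>\<^bsub>x\<^sub>0\<^esub>(l)]\<close>.\<close>

section \<open>Modules\<close>

text \<open>The algebraic obstacle is that a linear map out of F^G cannot be prescribed freely: the
  generators at the points of one orbit coincide up to transport of coefficients. Moreover the
  induced maps, and with them the differential, are definite descriptions, so nothing is known about
  them until the generators are shown to span (uniqueness) and compatible values on them are shown
  to extend (existence). The extension result is used twice, for the face maps and for the
  augmentation.

  The topological obstacle is that \<open>X\<close> has no cells of its own. Connectedness is
  therefore exploited on the image of X^H in Y^H, and the paths found there are carried back along
  the homotopy inverse.

  A subgroup in the family need not be an isotropy group. Its summand reaches homology through the
  isotropy group of the point chosen for it; surjectivity holds because every isotropy group is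
  itself in the family.

  Finally, the base point of \<open>plus_space X\<close> is isolated. No edge joins it to a point of
  \<open>X\<close>, so setting the augmentation to zero there does no harm.\<close>

lemma lin_mapsI:
  assumes "\<And>x. x \<in> carrier A \<Longrightarrow> h x \<in> carrier B"
    and "\<And>x y. x \<in> carrier A \<Longrightarrow> y \<in> carrier A \<Longrightarrow> h (x \<oplus>\<^bsub>A\<^esub> y) = h x \<oplus>\<^bsub>B\<^esub> h y"
    and "\<And>r x. r \<in> carrier R \<Longrightarrow> x \<in> carrier A \<Longrightarrow> h (r \<odot>\<^bsub>A\<^esub> x) = r \<odot>\<^bsub>B\<^esub> h x"
  shows "h \<in> lin_maps R A B"
  using assms by (auto simp: lin_maps_def)

lemma lin_maps_closed: "h \<in> lin_maps R A B \<Longrightarrow> x \<in> carrier A \<Longrightarrow> h x \<in> carrier B"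
  and lin_maps_add: "h \<in> lin_maps R A B \<Longrightarrow> x \<in> carrier A \<Longrightarrow> y \<in> carrier A
        \<Longrightarrow> h (x \<oplus>\<^bsub>A\<^esub> y) = h x \<oplus>\<^bsub>B\<^esub> h y"
  and lin_maps_smult: "h \<in> lin_maps R A B \<Longrightarrow> r \<in> carrier R \<Longrightarrow> x \<in> carrier A
        \<Longrightarrow> h (r \<odot>\<^bsub>A\<^esub> x) = r \<odot>\<^bsub>B\<^esub> h x"
  by (auto simp: lin_maps_def)

lemma lin_maps_comp:
  assumes "f \<in> lin_maps R A B" "g \<in> lin_maps R B C"
  shows "(\<lambda>x. g (f x)) \<in> lin_maps R A C"
  using assms by (auto simp: lin_maps_def Pi_iff)

text \<open>Linearity only concerns values on the carrier, which is closed under the operations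
  because \<open>A\<close> is a module. Needed for restrictions, and for the boundary, whose
  explicit form is available on chains only.\<close>

lemma lin_maps_cong:
  assumes "Module.module R A" "f \<in> lin_maps R A B" "\<And>x. x \<in> carrier A \<Longrightarrow> g x = f x"
  shows "g \<in> lin_maps R A B"
proof -
  interpret A: Module.module R A by fact
  show ?thesis using assms(2,3) by (auto simp: lin_maps_def Pi_iff)
qed

lemma lin_maps_zero:
  assumes "Module.module R A" "Module.module R B" "h \<in> lin_maps R A B"
  shows "h \<zero>\<^bsub>A\<^esub> = \<zero>\<^bsub>B\<^esub>"
proof -
  interpret A: Module.module R A by fact
  interpret B: Module.module R B by fact
  have "h \<zero>\<^bsub>A\<^esub> = h (\<zero>\<^bsub>R\<^esub> \<odot>\<^bsub>A\<^esub> \<zero>\<^bsub>A\<^esub>)" by simp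
  also have "\<dots> = \<zero>\<^bsub>R\<^esub> \<odot>\<^bsub>B\<^esub> h \<zero>\<^bsub>A\<^esub>" by (rule lin_maps_smult[OF assms(3)]) simp_all
  also have "\<dots> = \<zero>\<^bsub>B\<^esub>" using lin_maps_closed[OF assms(3)] by simp
  finally show ?thesis .
qed

lemma lin_maps_neg:
  assumes "Module.module R A" "Module.module R B" "h \<in> lin_maps R A B" "x \<in> carrier A"
  shows "h (\<ominus>\<^bsub>A\<^esub> x) = \<ominus>\<^bsub>B\<^esub> h x"
proof -
  interpret A: Module.module R A by fact
  interpret B: Module.module R B by fact
  have "h (\<ominus>\<^bsub>A\<^esub> x) = h ((\<ominus>\<^bsub>R\<^esub> \<one>\<^bsub>R\<^esub>) \<odot>\<^bsub>A\<^esub> x)"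
    using assms(4) by (simp add: A.smult_l_minus)
  also have "\<dots> = (\<ominus>\<^bsub>R\<^esub> \<one>\<^bsub>R\<^esub>) \<odot>\<^bsub>B\<^esub> h x"
    by (rule lin_maps_smult[OF assms(3)]) (simp_all add: assms(4))
  also have "\<dots> = \<ominus>\<^bsub>B\<^esub> h x"
    using lin_maps_closed[OF assms(3,4)] by (simp add: B.smult_l_minus)
  finally show ?thesis .
qed

lemma lin_maps_diff:
  assumes "Module.module R A" "Module.module R B" "h \<in> lin_maps R A B"
    "x \<in> carrier A" "y \<in> carrier A"
  shows "h (x \<ominus>\<^bsub>A\<^esub> y) = h x \<ominus>\<^bsub>B\<^esub> h y"
proof -
  interpret A: Module.module R A by fact
  show ?thesis unfolding a_minus_def
    using assms by (simp add: lin_maps_neg[OF assms(1-3)] lin_maps_add[OF assms(3)])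
qed

lemma lin_maps_image_submodule:
  assumes "Module.module R A" "Module.module R B" "h \<in> lin_maps R A B"
  shows "submodule (h ` carrier A) R B"
proof -
  interpret A: Module.module R A by fact
  interpret B: Module.module R B by fact
  show ?thesis
  proof (rule B.submoduleI)
    show "h ` carrier A \<subseteq> carrier B" using lin_maps_closed[OF assms(3)] by auto
    show "\<zero>\<^bsub>B\<^esub> \<in> h ` carrier A"
      using lin_maps_zero[OF assms] by (metis A.zero_closed imageI)
  next
    fix a assume "a \<in> h ` carrier A"
    then show "\<ominus>\<^bsub>B\<^esub> a \<in> h ` carrier A"
      using lin_maps_neg[OF assms] by (metis (no_types, opaque_lifting) A.a_inv_closed imageE imageI)
  next
    fix a b assume "a \<in> h ` carrier A" "b \<in> h ` carrier A"
    then show "a \<oplus>\<^bsub>B\<^esub> b \<in> h ` carrier A"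
      using lin_maps_add[OF assms(3)] by (metis (no_types, opaque_lifting) A.add.m_closed imageE imageI)
  next
    fix r a assume "r \<in> carrier R" "a \<in> h ` carrier A"
    then show "r \<odot>\<^bsub>B\<^esub> a \<in> h ` carrier A"
      using lin_maps_smult[OF assms(3)] by (metis (no_types, opaque_lifting) A.smult_closed imageE imageI)
  qed
qed

lemma lin_maps_kernel_submodule:
  assumes "Module.module R A" "Module.module R B" "h \<in> lin_maps R A B"
  shows "submodule {a \<in> carrier A. h a = \<zero>\<^bsub>B\<^esub>} R A"
proof -
  interpret A: Module.module R A by fact
  interpret B: Module.module R B by fact
  show ?thesis
    by (rule A.submoduleI)
      (auto simp: lin_maps_zero[OF assms] lin_maps_neg[OF assms] lin_maps_add[OF assms(3)]
        lin_maps_smult[OF assms(3)])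
qed

lemma lin_maps_finsum:
  assumes "Module.module R A" "Module.module R B" "h \<in> lin_maps R A B"
    and "finite I" "f \<in> I \<rightarrow> carrier A"
  shows "h (finsum A f I) = finsum B (\<lambda>i. h (f i)) I"
proof -
  interpret A: Module.module R A by fact
  interpret B: Module.module R B by fact
  show ?thesis using assms(4,5)
  proof (induction I rule: finite_induct)
    case empty
    then show ?case using lin_maps_zero[OF assms(1-3)] by simp
  next
    case (insert i I)
    have "h (finsum A f (insert i I)) = h (f i \<oplus>\<^bsub>A\<^esub> finsum A f I)"
      using insert by (simp add: Pi_iff)
    also have "\<dots> = h (f i) \<oplus>\<^bsub>B\<^esub> h (finsum A f I)"
      using insert by (intro lin_maps_add[OF assms(3)]) (auto intro!: A.finsum_closed)
    also have "\<dots> = finsum B (\<lambda>i. h (f i)) (insert i I)"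
      using insert lin_maps_closed[OF assms(3)] by (subst B.finsum_insert) (auto simp: Pi_iff)
    finally show ?case .
  qed
qed

section \<open>Quotient modules and the first isomorphism theorem\<close>

lemma quot_module_carrier:
  "carrier (quot_module A N) = (\<lambda>a. N +>\<^bsub>A\<^esub> a) ` carrier A"
  unfolding quot_module_def by (auto simp: A_RCOSETS_def')

lemma quot_module_add:
  assumes "Module.module R A" "submodule N R A" "a \<in> carrier A" "b \<in> carrier A"
  shows "(N +>\<^bsub>A\<^esub> a) \<oplus>\<^bsub>quot_module A N\<^esub> (N +>\<^bsub>A\<^esub> b) = N +>\<^bsub>A\<^esub> (a \<oplus>\<^bsub>A\<^esub> b)"
proof -
  interpret A: Module.module R A by fact
  interpret N: abelian_subgroup N A
    by (rule abelian_subgroupI3)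
      (auto simp: A.abelian_group_axioms additive_subgroup_def submodule.axioms(1)[OF assms(2)])
  show ?thesis unfolding quot_module_def using N.a_rcos_sum[OF assms(3,4)] by simp
qed

lemma quot_module_eq_iff:
  assumes "Module.module R A" "submodule N R A" "a \<in> carrier A" "b \<in> carrier A"
  shows "N +>\<^bsub>A\<^esub> a = N +>\<^bsub>A\<^esub> b \<longleftrightarrow> a \<ominus>\<^bsub>A\<^esub> b \<in> N"
proof -
  interpret A: Module.module R A by fact
  interpret N: abelian_subgroup N A
    by (rule abelian_subgroupI3)
      (auto simp: A.abelian_group_axioms additive_subgroup_def submodule.axioms(1)[OF assms(2)])
  show ?thesis
    using N.a_rcos_module[OF assms(4,3)] N.a_rcos_self
      N.a_repr_independence'[OF _ assms(4)] assms(3) unfolding a_minus_def by metis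
qed

text \<open>A scalar multiple in the quotient is a union over all representatives of the coset. They
  all yield the same coset because \<open>r\<close> maps \<open>N\<close> into itself, and there is
  at least one, so the union collapses.\<close>

lemma quot_module_smult:
  assumes "Module.module R A" "submodule N R A" "r \<in> carrier R" "a \<in> carrier A"
  shows "r \<odot>\<^bsub>quot_module A N\<^esub> (N +>\<^bsub>A\<^esub> a) = N +>\<^bsub>A\<^esub> (r \<odot>\<^bsub>A\<^esub> a)"
proof -
  interpret A: Module.module R A by fact
  interpret N: submodule N R A by fact
  have sub: "\<And>n. n \<in> N \<Longrightarrow> n \<in> carrier A" using N.subset by auto
  have "N +>\<^bsub>A\<^esub> (r \<odot>\<^bsub>A\<^esub> (n \<oplus>\<^bsub>A\<^esub> a)) = N +>\<^bsub>A\<^esub> (r \<odot>\<^bsub>A\<^esub> a)" if "n \<in> N" for n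
  proof (subst quot_module_eq_iff[OF assms(1,2)])
    have "r \<odot>\<^bsub>A\<^esub> (n \<oplus>\<^bsub>A\<^esub> a) \<ominus>\<^bsub>A\<^esub> r \<odot>\<^bsub>A\<^esub> a = r \<odot>\<^bsub>A\<^esub> n"
      using assms sub[OF that]
      by (simp add: A.smult_r_distr a_minus_def A.add.m_assoc A.r_neg)
    then show "r \<odot>\<^bsub>A\<^esub> (n \<oplus>\<^bsub>A\<^esub> a) \<ominus>\<^bsub>A\<^esub> r \<odot>\<^bsub>A\<^esub> a \<in> N"
      using that assms by simp
  qed (use assms sub[OF that] in auto)
  moreover have "N \<noteq> {}" using N.one_closed by auto
  ultimately show ?thesis
    unfolding quot_module_def a_r_coset_def' by auto
qed

lemma quot_module_zero:
  assumes "Module.module R A" "submodule N R A"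
  shows "\<zero>\<^bsub>quot_module A N\<^esub> = N +>\<^bsub>A\<^esub> \<zero>\<^bsub>A\<^esub>"
proof -
  interpret A: Module.module R A by fact
  show ?thesis
    using submodule.axioms(1)[OF assms(2)] subgroup.subset
    unfolding quot_module_def by (fastforce simp: A.a_coset_add_zero)
qed

lemma quot_module_module:
  assumes "Module.module R A" "submodule N R A"
  shows "Module.module R (quot_module A N)"
proof -
  interpret A: Module.module R A by fact
  note simps = quot_module_carrier quot_module_add[OF assms] quot_module_smult[OF assms]
    quot_module_zero[OF assms]
  show ?thesis
  proof (rule moduleI)
    show "cring R" by (rule Module.module.axioms(1)[OF assms(1)])
    show "abelian_group (quot_module A N)"
    proof (rule abelian_groupI)
      fix x assume "x \<in> carrier (quot_module A N)"
      then obtain a where a: "a \<in> carrier A" "x = N +>\<^bsub>A\<^esub> a" by (auto simp: simps)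
      then show "\<exists>y\<in>carrier (quot_module A N). y \<oplus>\<^bsub>quot_module A N\<^esub> x = \<zero>\<^bsub>quot_module A N\<^esub>"
        by (intro bexI[of _ "N +>\<^bsub>A\<^esub> (\<ominus>\<^bsub>A\<^esub> a)"]) (auto simp: simps A.l_neg)
    qed (auto simp: simps A.a_ac)
  qed (auto simp: simps A.smult_l_distr A.smult_r_distr A.smult_assoc1)
qed

lemma quot_module_proj:
  assumes "Module.module R A" "submodule N R A"
  shows "(\<lambda>a. N +>\<^bsub>A\<^esub> a) \<in> lin_maps R A (quot_module A N)"
  by (intro lin_mapsI)
    (auto simp: quot_module_carrier quot_module_add[OF assms] quot_module_smult[OF assms])

lemma first_isomorphism:
  assumes A: "Module.module R A" and B: "Module.module R B" and h: "h \<in> lin_maps R A B"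
    and surj: "h ` carrier A = carrier B"
  shows "module_iso R (quot_module A {a \<in> carrier A. h a = \<zero>\<^bsub>B\<^esub>}) B"
proof -
  interpret A: Module.module R A by fact
  interpret B: Module.module R B by fact
  define N where "N = {a \<in> carrier A. h a = \<zero>\<^bsub>B\<^esub>}"
  have N: "submodule N R A" unfolding N_def by (rule lin_maps_kernel_submodule[OF A B h])
  \<comment> \<open>\<open>k\<close> evaluates \<open>h\<close> at an arbitrary representative; the
    choice is harmless because \<open>h\<close> is constant on the cosets of its kernel.\<close>
  define k where "k = (\<lambda>C. h (SOME c. c \<in> C))"
  have k: "k (N +>\<^bsub>A\<^esub> a) = h a" if a: "a \<in> carrier A" for a
  proof -
    have "h c = h a" if "c \<in> N +>\<^bsub>A\<^esub> a" for c
      using that a lin_maps_closed[OF h a]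
      by (auto simp: a_r_coset_def' N_def lin_maps_add[OF h])
    moreover have "\<exists>c. c \<in> N +>\<^bsub>A\<^esub> a"
      using submodule.axioms(1)[OF N] subgroup.one_closed by (fastforce simp: a_r_coset_def')
    ultimately show ?thesis unfolding k_def by (metis someI_ex)
  qed
  have "k \<in> lin_maps R (quot_module A N) B"
    by (rule lin_mapsI)
      (auto simp: quot_module_carrier quot_module_add[OF A N] quot_module_smult[OF A N] k
        lin_maps_add[OF h] lin_maps_smult[OF h] lin_maps_closed[OF h])
  moreover have "bij_betw k (carrier (quot_module A N)) (carrier B)"
  proof (rule bij_betw_imageI)
    show "inj_on k (carrier (quot_module A N))"
    proof (rule inj_onI, clarsimp simp: quot_module_carrier k)
      fix a b assume ab: "a \<in> carrier A" "b \<in> carrier A" "h a = h b"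
      then have "h (a \<ominus>\<^bsub>A\<^esub> b) = h b \<ominus>\<^bsub>B\<^esub> h b"
        by (simp add: lin_maps_diff[OF A B h])
      also have "\<dots> = \<zero>\<^bsub>B\<^esub>"
        using lin_maps_closed[OF h ab(2)] by (simp add: a_minus_def B.r_neg)
      finally have "h (a \<ominus>\<^bsub>A\<^esub> b) = \<zero>\<^bsub>B\<^esub>" .
      with ab show "N +>\<^bsub>A\<^esub> a = N +>\<^bsub>A\<^esub> b"
        by (simp add: quot_module_eq_iff[OF A N]) (simp add: N_def)
    qed
    have "k ` carrier (quot_module A N) = h ` carrier A"
      unfolding quot_module_carrier image_image by (intro image_cong) (auto simp: k)
    then show "k ` carrier (quot_module A N) = carrier B" using surj by simp
  qed
  ultimately show ?thesis unfolding module_iso_def N_def by blast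
qed

lemma is_quotient_ofI:
  assumes "Module.module R A" "Module.module R B" "h \<in> lin_maps R A B"
    "h ` carrier A = carrier B"
  shows "is_quotient_of R B A"
  unfolding is_quotient_of_def
  using first_isomorphism[OF assms] lin_maps_kernel_submodule[OF assms(1-3)] by blast

section \<open>Direct sums and further linear maps\<close>

lemma direct_sum_module:
  assumes R: "cring R" and A: "\<And>i. i \<in> I \<Longrightarrow> Module.module R (A i)"
  shows "Module.module R (direct_sum I A)"
proof -
  note m = Module.module.axioms[OF A] 
  note ab = abelian_group.axioms(1)[OF m(2)]
  have add: "a \<oplus>\<^bsub>A i\<^esub> b \<in> carrier (A i)" "a \<oplus>\<^bsub>A i\<^esub> b = b \<oplus>\<^bsub>A i\<^esub> a"
    if "i \<in> I" "a \<in> carrier (A i)" "b \<in> carrier (A i)" for i a b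
    using that abelian_monoid.a_closed[OF ab] abelian_monoid.a_comm[OF ab] by auto
  have assoc: "a \<oplus>\<^bsub>A i\<^esub> b \<oplus>\<^bsub>A i\<^esub> c = a \<oplus>\<^bsub>A i\<^esub> (b \<oplus>\<^bsub>A i\<^esub> c)"
    if "i \<in> I" "a \<in> carrier (A i)" "b \<in> carrier (A i)" "c \<in> carrier (A i)" for i a b c
    using that abelian_monoid.a_assoc[OF ab] by auto
  have zero: "\<zero>\<^bsub>A i\<^esub> \<in> carrier (A i)" if "i \<in> I" for i
    using that abelian_monoid.zero_closed[OF ab] by auto
  have lz: "\<zero>\<^bsub>A i\<^esub> \<oplus>\<^bsub>A i\<^esub> a = a" if "i \<in> I" "a \<in> carrier (A i)" for i a
    using that abelian_monoid.l_zero[OF ab] by auto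
  have neg: "\<ominus>\<^bsub>A i\<^esub> a \<in> carrier (A i)" "\<ominus>\<^bsub>A i\<^esub> a \<oplus>\<^bsub>A i\<^esub> a = \<zero>\<^bsub>A i\<^esub>"
    if "i \<in> I" "a \<in> carrier (A i)" for i a
    using that abelian_group.a_inv_closed[OF m(2)] abelian_group.l_neg[OF m(2)] by auto
  have smz: "r \<odot>\<^bsub>A i\<^esub> \<zero>\<^bsub>A i\<^esub> = \<zero>\<^bsub>A i\<^esub>" if "i \<in> I" "r \<in> carrier R" for i r
    using that Module.module.smult_r_null[OF A] by auto
  have negz: "\<ominus>\<^bsub>A i\<^esub> \<zero>\<^bsub>A i\<^esub> = \<zero>\<^bsub>A i\<^esub>" if "i \<in> I" for i
    using neg[OF that zero[OF that]] lz[OF that] add zero that by metis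
  let ?D = "direct_sum I A"
  let ?s = "\<lambda>f. {i \<in> I. f i \<noteq> \<zero>\<^bsub>A i\<^esub>}"
  \<comment> \<open>The module laws hold coordinatewise; what needs an argument is finiteness of the
    support, and the support of a sum lies in the union of the two supports.\<close>
  have addc: "f \<oplus>\<^bsub>?D\<^esub> g \<in> carrier ?D" if "f \<in> carrier ?D" "g \<in> carrier ?D" for f g
  proof -
    have fin: "finite (?s f)" "finite (?s g)" using that by (auto simp: direct_sum_def)
    have "?s (\<lambda>i\<in>I. f i \<oplus>\<^bsub>A i\<^esub> g i) \<subseteq> ?s f \<union> ?s g"
      using lz zero by auto
    then have "finite (?s (\<lambda>i\<in>I. f i \<oplus>\<^bsub>A i\<^esub> g i))"
      using fin by (meson finite_UnI finite_subset)
    then show ?thesis using that add(1) by (auto simp: direct_sum_def PiE_iff)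
  qed
  have smc: "r \<odot>\<^bsub>?D\<^esub> f \<in> carrier ?D" if "r \<in> carrier R" "f \<in> carrier ?D" for r f
  proof -
    have fin: "finite (?s f)" using that by (auto simp: direct_sum_def)
    have "?s (\<lambda>i\<in>I. r \<odot>\<^bsub>A i\<^esub> f i) \<subseteq> ?s f"
      using smz that(1) by auto
    then have "finite (?s (\<lambda>i\<in>I. r \<odot>\<^bsub>A i\<^esub> f i))"
      using fin by (meson finite_subset)
    then show ?thesis using that Module.module.smult_closed[OF A] by (auto simp: direct_sum_def PiE_iff)
  qed
  show ?thesis
  proof (rule moduleI)
    show "abelian_group ?D"
    proof (rule abelian_groupI)
      fix f assume f: "f \<in> carrier ?D"
      let ?g = "\<lambda>i\<in>I. \<ominus>\<^bsub>A i\<^esub> f i"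
      have "?s ?g \<subseteq> ?s f" using negz by auto
      moreover have "finite (?s f)" using f by (auto simp: direct_sum_def)
      ultimately have "finite (?s ?g)" by (rule finite_subset)
      then have "?g \<in> carrier ?D" using f neg(1) by (auto simp: direct_sum_def PiE_iff)
      moreover have "?g \<oplus>\<^bsub>?D\<^esub> f = \<zero>\<^bsub>?D\<^esub>"
        using f neg by (auto simp: direct_sum_def PiE_iff intro!: restrict_ext)
      ultimately show "\<exists>y\<in>carrier ?D. y \<oplus>\<^bsub>?D\<^esub> f = \<zero>\<^bsub>?D\<^esub>" by blast
    next
      fix f assume f: "f \<in> carrier ?D"
      then have fi: "\<And>i. i \<in> I \<Longrightarrow> f i \<in> carrier (A i)" "f \<in> extensional I"
        by (auto simp: direct_sum_def PiE_iff)
      then show "\<zero>\<^bsub>?D\<^esub> \<oplus>\<^bsub>?D\<^esub> f = f"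
        unfolding direct_sum_def by (auto intro!: extensionalityI[of _ I] simp: lz)
    next
      show "\<zero>\<^bsub>?D\<^esub> \<in> carrier ?D" using zero by (auto simp: direct_sum_def)
    next
      fix f g assume "f \<in> carrier ?D" "g \<in> carrier ?D"
      then show "f \<oplus>\<^bsub>?D\<^esub> g = g \<oplus>\<^bsub>?D\<^esub> f"
        using add by (auto simp: direct_sum_def PiE_iff intro!: restrict_ext)
    next
      fix f g h assume "f \<in> carrier ?D" "g \<in> carrier ?D" "h \<in> carrier ?D"
      then show "f \<oplus>\<^bsub>?D\<^esub> g \<oplus>\<^bsub>?D\<^esub> h = f \<oplus>\<^bsub>?D\<^esub> (g \<oplus>\<^bsub>?D\<^esub> h)"
        using assoc by (auto simp: direct_sum_def PiE_iff intro!: restrict_ext)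
    qed (rule addc)
  next
    fix r s f assume "r \<in> carrier R" "s \<in> carrier R" "f \<in> carrier ?D"
    then show "(r \<oplus>\<^bsub>R\<^esub> s) \<odot>\<^bsub>?D\<^esub> f = r \<odot>\<^bsub>?D\<^esub> f \<oplus>\<^bsub>?D\<^esub> s \<odot>\<^bsub>?D\<^esub> f"
      "r \<otimes>\<^bsub>R\<^esub> s \<odot>\<^bsub>?D\<^esub> f = r \<odot>\<^bsub>?D\<^esub> (s \<odot>\<^bsub>?D\<^esub> f)"
      using Module.module.smult_l_distr[OF A] Module.module.smult_assoc1[OF A]
      by (auto simp: direct_sum_def PiE_iff intro!: restrict_ext)
  next
    fix r f g assume "r \<in> carrier R" "f \<in> carrier ?D" "g \<in> carrier ?D"
    then show "r \<odot>\<^bsub>?D\<^esub> (f \<oplus>\<^bsub>?D\<^esub> g) = r \<odot>\<^bsub>?D\<^esub> f \<oplus>\<^bsub>?D\<^esub> r \<odot>\<^bsub>?D\<^esub> g"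
      using Module.module.smult_r_distr[OF A]
      by (auto simp: direct_sum_def PiE_iff intro!: restrict_ext)
  next
    fix f assume "f \<in> carrier ?D"
    then have fi: "\<And>i. i \<in> I \<Longrightarrow> f i \<in> carrier (A i)" "f \<in> extensional I"
      by (auto simp: direct_sum_def PiE_iff)
    then show "\<one>\<^bsub>R\<^esub> \<odot>\<^bsub>?D\<^esub> f = f"
      unfolding direct_sum_def
      by (auto intro!: extensionalityI[of _ I] simp: Module.module.smult_one[OF A])
  qed (use R smc in auto)
qed

text \<open>Serves to test surjectivity on generators: the chains whose class lies in a given image
  form a submodule.\<close>

lemma lin_maps_preimage_submodule:
  assumes "Module.module R A" "Module.module R B" "h \<in> lin_maps R A B" "submodule N R B"
  shows "submodule {a \<in> carrier A. h a \<in> N} R A"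
proof -
  interpret A: Module.module R A by fact
  interpret B: Module.module R B by fact
  note N = B.submoduleE[OF assms(4)] subgroup.one_closed[OF submodule.axioms(1)[OF assms(4)]]
  show ?thesis
    by (rule A.submoduleI)
      (use N in \<open>auto simp: lin_maps_zero[OF assms(1-3)] lin_maps_neg[OF assms(1-3)]
        lin_maps_add[OF assms(3)] lin_maps_smult[OF assms(3)]\<close>)
qed

lemma lin_maps_sub:
  assumes A: "Module.module R A" and B: "Module.module R B"
    and f: "f \<in> lin_maps R A B" and g: "g \<in> lin_maps R A B"
  shows "(\<lambda>x. f x \<ominus>\<^bsub>B\<^esub> g x) \<in> lin_maps R A B"
proof -
  interpret A: Module.module R A by fact
  interpret B: Module.module R B by fact
  note c = lin_maps_closed[OF f] lin_maps_closed[OF g]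
  show ?thesis
  proof (rule lin_mapsI)
    fix x y assume xy: "x \<in> carrier A" "y \<in> carrier A"
    show "f (x \<oplus>\<^bsub>A\<^esub> y) \<ominus>\<^bsub>B\<^esub> g (x \<oplus>\<^bsub>A\<^esub> y) = (f x \<ominus>\<^bsub>B\<^esub> g x) \<oplus>\<^bsub>B\<^esub> (f y \<ominus>\<^bsub>B\<^esub> g y)"
      using xy c by (simp add: lin_maps_add[OF f] lin_maps_add[OF g] a_minus_def B.minus_add B.a_ac)
  next
    fix r x assume rx: "r \<in> carrier R" "x \<in> carrier A"
    show "f (r \<odot>\<^bsub>A\<^esub> x) \<ominus>\<^bsub>B\<^esub> g (r \<odot>\<^bsub>A\<^esub> x) = r \<odot>\<^bsub>B\<^esub> (f x \<ominus>\<^bsub>B\<^esub> g x)"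
      using rx c by (simp add: lin_maps_smult[OF f] lin_maps_smult[OF g] a_minus_def
          B.smult_r_distr B.smult_r_minus)
  qed (use c in \<open>simp add: a_minus_def\<close>)
qed

lemma lin_maps_const_zero:
  assumes "Module.module R B"
  shows "(\<lambda>x. \<zero>\<^bsub>B\<^esub>) \<in> lin_maps R A B"
proof -
  interpret B: Module.module R B by fact
  show ?thesis by (rule lin_mapsI) auto
qed

text \<open>The universal property of the direct sum. Finiteness of \<open>I\<close> allows one sum
  over all indices instead of a sum over a support that varies with \<open>m\<close>.\<close>

lemma direct_sum_extend:
  assumes C: "Module.module R C" and I: "finite I"
    and f: "\<And>i. i \<in> I \<Longrightarrow> f i \<in> lin_maps R (A i) C"
  shows "(\<lambda>m. \<Oplus>\<^bsub>C\<^esub> i\<in>I. f i (m i)) \<in> lin_maps R (direct_sum I A) C"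
proof -
  interpret C: Module.module R C by fact
  have mem: "m i \<in> carrier (A i)" if "m \<in> carrier (direct_sum I A)" "i \<in> I" for m i
    using that by (auto simp: direct_sum_def)
  have fc: "(\<lambda>i. f i (m i)) \<in> I \<rightarrow> carrier C" if "m \<in> carrier (direct_sum I A)" for m
    using lin_maps_closed[OF f] mem[OF that] by auto
  show ?thesis
  proof (rule lin_mapsI)
    fix m n assume mn: "m \<in> carrier (direct_sum I A)" "n \<in> carrier (direct_sum I A)"
    have "(\<Oplus>\<^bsub>C\<^esub> i\<in>I. f i ((m \<oplus>\<^bsub>direct_sum I A\<^esub> n) i)) = (\<Oplus>\<^bsub>C\<^esub> i\<in>I. f i (m i) \<oplus>\<^bsub>C\<^esub> f i (n i))"
      using lin_maps_add[OF f] mem mn lin_maps_closed[OF f]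
      by (intro C.finsum_cong') (auto simp: direct_sum_def)
    then show "(\<Oplus>\<^bsub>C\<^esub> i\<in>I. f i ((m \<oplus>\<^bsub>direct_sum I A\<^esub> n) i))
        = (\<Oplus>\<^bsub>C\<^esub> i\<in>I. f i (m i)) \<oplus>\<^bsub>C\<^esub> (\<Oplus>\<^bsub>C\<^esub> i\<in>I. f i (n i))"
      using C.finsum_addf[OF fc[OF mn(1)] fc[OF mn(2)]] by simp
  next
    fix r m assume rm: "r \<in> carrier R" "m \<in> carrier (direct_sum I A)"
    have "(\<Oplus>\<^bsub>C\<^esub> i\<in>I. f i ((r \<odot>\<^bsub>direct_sum I A\<^esub> m) i)) = (\<Oplus>\<^bsub>C\<^esub> i\<in>I. r \<odot>\<^bsub>C\<^esub> f i (m i))"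
      using lin_maps_smult[OF f] mem rm lin_maps_closed[OF f]
      by (intro C.finsum_cong') (auto simp: direct_sum_def)
    then show "(\<Oplus>\<^bsub>C\<^esub> i\<in>I. f i ((r \<odot>\<^bsub>direct_sum I A\<^esub> m) i)) = r \<odot>\<^bsub>C\<^esub> (\<Oplus>\<^bsub>C\<^esub> i\<in>I. f i (m i))"
      using C.finsum_smult_ldistr[OF I rm(1) fc[OF rm(2)]] by simp
  qed (use fc in \<open>auto intro: C.finsum_closed\<close>)
qed

section \<open>Coefficient systems\<close>

context group
begin

section \<open>Left cosets and maps between orbits\<close>

lemma lcosets_iff: "C \<in> lcosets H \<longleftrightarrow> (\<exists>a\<in>carrier G. C = a <# H)"
  by (auto simp: LCOSETS_def)

lemma l_coset_eqI:
  assumes H: "subgroup H G" and "a \<in> carrier G" "b \<in> carrier G" "inv a \<otimes> b \<in> H"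
  shows "a <# H = b <# H"
proof -
  have "a \<otimes> (inv a \<otimes> b) = b" using assms by (simp add: m_assoc[symmetric])
  then have "b \<in> a <# H" using assms(4) unfolding l_coset_def by force
  then show ?thesis using l_repr_independence[OF _ assms(2) H] by simp
qed

text \<open>Writing \<open>h b = b (b^-1 h b)\<close> moves an element of \<open>H\<close> past
  \<open>b\<close> and into \<open>K\<close>. This is why the set product in
  \<open>orbit_map\<close> is a single coset.\<close>

lemma orbit_map_coset:
  assumes H: "subgroup H G" and K: "subgroup K G" and a: "a \<in> carrier G" and b: "b \<in> carrier G"
    and conj: "\<And>h. h \<in> H \<Longrightarrow> inv b \<otimes> h \<otimes> b \<in> K"
  shows "orbit_map G H K b (a <# H) = (a \<otimes> b) <# K"
proof -
  interpret H: subgroup H G by fact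
  interpret K: subgroup K G by fact
  have mem: "a <# H \<in> lcosets H" using a by (auto simp: lcosets_iff)
  have 1: "a \<otimes> h \<otimes> (b \<otimes> k) = (a \<otimes> b) \<otimes> (inv b \<otimes> h \<otimes> b \<otimes> k)" if "h \<in> H" "k \<in> K" for h k
    using a b that by (simp add: m_assoc inv_solve_left') (simp add: m_assoc[symmetric])
  have "(a <# H) <#> (b <# K) = (a \<otimes> b) <# K"
  proof
    show "(a <# H) <#> (b <# K) \<subseteq> (a \<otimes> b) <# K"
      using 1 conj by (fastforce simp: set_mult_def l_coset_def)
    show "(a \<otimes> b) <# K \<subseteq> (a <# H) <#> (b <# K)"
    proof
      fix x assume "x \<in> (a \<otimes> b) <# K"
      then obtain k where k: "k \<in> K" "x = a \<otimes> b \<otimes> k" by (auto simp: l_coset_def)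
      then have "x = a \<otimes> \<one> \<otimes> (b \<otimes> k)" using a b by (simp add: m_assoc)
      then show "x \<in> (a <# H) <#> (b <# K)"
        using k H.one_closed unfolding set_mult_def l_coset_def by blast
    qed
  qed
  then show ?thesis using mem by (simp add: orbit_map_def)
qed

lemma orbit_map_hom:
  assumes H: "subgroup H G" and K: "subgroup K G" and b: "b \<in> carrier G"
    and conj: "\<And>h. h \<in> H \<Longrightarrow> inv b \<otimes> h \<otimes> b \<in> K"
  shows "orbit_map G H K b \<in> orbit_hom G H K"
proof -
  have sub: "H \<subseteq> carrier G" "K \<subseteq> carrier G" using H K subgroup.subset by auto
  show ?thesis
    unfolding orbit_hom_def
  proof (clarsimp, intro conjI ballI)
    show "orbit_map G H K b \<in> (lcosets H) \<rightarrow>\<^sub>E (lcosets K)"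
    proof (rule PiE_I)
      fix C assume "C \<in> lcosets H"
      then obtain a where "a \<in> carrier G" "C = a <# H" by (auto simp: lcosets_iff)
      then show "orbit_map G H K b C \<in> lcosets K"
        using orbit_map_coset[OF H K _ b conj] b by (auto simp: lcosets_iff)
    qed (simp add: orbit_map_def)
    fix g C assume g: "g \<in> carrier G" and "C \<in> lcosets H"
    then obtain a where a: "a \<in> carrier G" "C = a <# H" by (auto simp: lcosets_iff)
    have "g <# C = (g \<otimes> a) <# H" using a g sub by (simp add: lcos_m_assoc)
    then show "orbit_map G H K b (g <# C) = g <# orbit_map G H K b C"
      using orbit_map_coset[OF H K _ b conj] a b g sub by (simp add: lcos_m_assoc m_assoc)
  qed
qed

text \<open>These are right translations, a H to a b K to a b c L, so the map applied first
  contributes the left factor of the product.\<close>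

lemma orbit_map_compose:
  assumes H: "subgroup H G" and K: "subgroup K G" and L: "subgroup L G"
    and b: "b \<in> carrier G" and c: "c \<in> carrier G"
    and bconj: "\<And>h. h \<in> H \<Longrightarrow> inv b \<otimes> h \<otimes> b \<in> K"
    and cconj: "\<And>h. h \<in> K \<Longrightarrow> inv c \<otimes> h \<otimes> c \<in> L"
  shows "compose (lcosets H) (orbit_map G K L c) (orbit_map G H K b) = orbit_map G H L (b \<otimes> c)"
proof (rule extensionalityI[of _ "lcosets H"])
  interpret H: subgroup H G by fact
  have conj: "inv (b \<otimes> c) \<otimes> h \<otimes> (b \<otimes> c) \<in> L" if "h \<in> H" for h
    using cconj[OF bconj[OF that]] b c that by (simp add: inv_mult_group m_assoc)
  fix C assume C: "C \<in> lcosets H"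
  then obtain a where a: "a \<in> carrier G" "C = a <# H" by (auto simp: lcosets_iff)
  show "compose (lcosets H) (orbit_map G K L c) (orbit_map G H K b) C = orbit_map G H L (b \<otimes> c) C"
    using C a b c orbit_map_coset[OF H K _ b bconj] orbit_map_coset[OF K L _ c cconj]
      orbit_map_coset[OF H L _ _ conj] by (simp add: compose_eq m_assoc)
qed (auto simp: orbit_map_def)

lemma orbit_map_cong:
  assumes "subgroup K G" "b \<in> carrier G" "b' \<in> carrier G" "inv b \<otimes> b' \<in> K"
  shows "orbit_map G H K b = orbit_map G H K b'"
  unfolding orbit_map_def using l_coset_eqI[OF assms] by simp

lemma orbit_map_one:
  assumes H: "subgroup H G"
  shows "orbit_map G H H \<one> = (\<lambda>C\<in>lcosets H. C)"
proof (rule extensionalityI[of _ "lcosets H"])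
  interpret H: subgroup H G by fact
  fix C assume C: "C \<in> lcosets H"
  then obtain a where a: "a \<in> carrier G" "C = a <# H" by (auto simp: lcosets_iff)
  show "orbit_map G H H \<one> C = (\<lambda>C\<in>lcosets H. C) C"
    using orbit_map_coset[OF H H a(1) one_closed] a C by simp
qed (auto simp: orbit_map_def)

end

section \<open>Coefficients along maps of orbits\<close>

locale coeff_sys = group G for G :: "('g, 'c) monoid_scheme" (structure) +
  fixes R :: "('r, 'p) ring_scheme" and M :: "('g, 'r, 'm) coeff"
  assumes finite_group: "finite (carrier G)"
    and cring_R: "cring R"
    and coefficient_system: "coefficient_system G R M"
begin

abbreviation mor_by :: "'g set \<Rightarrow> 'g set \<Rightarrow> 'g \<Rightarrow> 'm \<Rightarrow> 'm"
  where "mor_by H K b \<equiv> mor M H K (orbit_map G H K b)"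

lemma obj_module: "subgroup H G \<Longrightarrow> Module.module R (obj M H)"
  using coefficient_system by (simp add: coefficient_system_def)

lemma mor_by_lin:
  assumes "subgroup H G" "subgroup K G" "b \<in> carrier G"
    and "\<And>h. h \<in> H \<Longrightarrow> inv b \<otimes> h \<otimes> b \<in> K"
  shows "mor_by H K b \<in> lin_maps R (obj M H) (obj M K)"
  using coefficient_system orbit_map_hom[OF assms] assms(1,2)
  by (simp add: coefficient_system_def)

lemma mor_by_comp:
  assumes "subgroup H G" "subgroup K G" "subgroup L G" "b \<in> carrier G" "c \<in> carrier G"
    and "\<And>h. h \<in> H \<Longrightarrow> inv b \<otimes> h \<otimes> b \<in> K" "\<And>h. h \<in> K \<Longrightarrow> inv c \<otimes> h \<otimes> c \<in> L"
    and "l \<in> carrier (obj M H)"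
  shows "mor_by K L c (mor_by H K b l) = mor_by H L (b \<otimes> c) l"
proof -
  have "mor M H L (compose (lcosets H) (orbit_map G K L c) (orbit_map G H K b)) l
      = mor_by K L c (mor_by H K b l)"
    using coefficient_system orbit_map_hom[OF assms(1,2,4,6)] orbit_map_hom[OF assms(2,3,5,7)]
      assms(1-3,8) unfolding coefficient_system_def by blast
  then show ?thesis using orbit_map_compose[OF assms(1-7)] by simp
qed

text \<open>Since \<open>b H = H\<close>, right translation by \<open>b\<close> is the identity of
  G/H. This is what makes transport independent of representatives.\<close>

lemma mor_by_id:
  assumes H: "subgroup H G" and b: "b \<in> H" and l: "l \<in> carrier (obj M H)"
  shows "mor_by H H b l = l"
proof -
  interpret H: subgroup H G by fact
  have "orbit_map G H H b = orbit_map G H H \<one>"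
    using b by (intro orbit_map_cong[OF H]) auto
  then show ?thesis
    using coefficient_system orbit_map_one[OF H] H l by (simp add: coefficient_system_def)
qed

end

section \<open>The functor \<open>F\<^sup>G(-, M)\<close>\<close>

locale pointed_gset = coeff_sys G R M
  for G :: "('g, 'c) monoid_scheme" (structure)
    and R :: "('r, 'p) ring_scheme" and M :: "('g, 'r, 'm) coeff" +
  fixes S :: "'s set" and \<psi> :: "'g \<Rightarrow> 's \<Rightarrow> 's" and s0 :: 's
  assumes action: "group_action G S \<psi>"
    and base: "s0 \<in> S"
    and base_fixed: "g \<in> carrier G \<Longrightarrow> \<psi> g s0 = s0"
begin

abbreviation st :: "'s \<Rightarrow> 'g set" where "st \<equiv> stabilizer G \<psi>"
abbreviation V :: "'s \<Rightarrow> ('r, 'm) module" where "V x \<equiv> obj M (st x)"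
abbreviation Rs :: "'g \<Rightarrow> 's \<Rightarrow> 'm \<Rightarrow> 'm" where "Rs \<equiv> R_star G M \<psi>"
abbreviation F :: "('r, 's \<Rightarrow> 'm) module" where "F \<equiv> F_mod G M S \<psi> s0"
abbreviation FG :: "('r, 's \<Rightarrow> 'm) module" where "FG \<equiv> FG_mod G M S \<psi> s0"
abbreviation \<gamma> :: "'s \<Rightarrow> 'm \<Rightarrow> 's \<Rightarrow> 'm" where "\<gamma> \<equiv> F_gamma G M S \<psi> s0"

section \<open>Isotropy groups and transport of coefficients along an orbit\<close>

lemma act_closed [simp]: "g \<in> carrier G \<Longrightarrow> x \<in> S \<Longrightarrow> \<psi> g x \<in> S"
  using group_action.element_image[OF action] by blast

lemma act_mult: "g \<in> carrier G \<Longrightarrow> h \<in> carrier G \<Longrightarrow> x \<in> S \<Longrightarrow> \<psi> (g \<otimes> h) x = \<psi> g (\<psi> h x)"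
  using group_action.composition_rule[OF action] by blast

lemma act_one [simp]: "x \<in> S \<Longrightarrow> \<psi> \<one> x = x"
  using group_action.id_eq_one[OF action] by (metis restrict_apply')

lemma act_inv [simp]:
  "g \<in> carrier G \<Longrightarrow> x \<in> S \<Longrightarrow> \<psi> (inv g) (\<psi> g x) = x"
  "g \<in> carrier G \<Longrightarrow> x \<in> S \<Longrightarrow> \<psi> g (\<psi> (inv g) x) = x"
  by (simp_all flip: act_mult)

lemma act_eq_base: "g \<in> carrier G \<Longrightarrow> x \<in> S \<Longrightarrow> \<psi> g x = s0 \<longleftrightarrow> x = s0"
  by (metis act_inv(1) base_fixed inv_closed)

lemma st_subgroup: "x \<in> S \<Longrightarrow> subgroup (st x) G"
  using group_action.stabilizer_subgroup[OF action] by blast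

lemma st_iff: "g \<in> st x \<longleftrightarrow> g \<in> carrier G \<and> \<psi> g x = x"
  by (auto simp: stabilizer_def)

text \<open>The double inverse is left unsimplified so that, for \<open>b = inv g\<close>, this is
  literally the side condition of \<open>mor_by_lin\<close> and \<open>mor_by_comp\<close>.\<close>

lemma st_conj:
  assumes "g \<in> carrier G" "x \<in> S" "h \<in> st x"
  shows "inv (inv g) \<otimes> h \<otimes> inv g \<in> st (\<psi> g x)"
  using assms by (simp add: st_iff act_mult)

lemma V_module: "x \<in> S \<Longrightarrow> Module.module R (V x)"
  by (rule obj_module[OF st_subgroup])

lemma V_zero [simp]: "x \<in> S \<Longrightarrow> \<zero>\<^bsub>V x\<^esub> \<in> carrier (V x)"
proof -
  assume "x \<in> S"
  then interpret Vx: Module.module R "V x" by (rule V_module)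
  show ?thesis by simp
qed

lemma Rs_lin:
  assumes "g \<in> carrier G" "x \<in> S"
  shows "Rs g x \<in> lin_maps R (V x) (V (\<psi> g x))"
  unfolding R_star_def Let_def
  using assms st_conj by (intro mor_by_lin) (auto simp: st_subgroup)

lemmas Rs_closed = lin_maps_closed[OF Rs_lin]

lemma Rs_zero: "g \<in> carrier G \<Longrightarrow> x \<in> S \<Longrightarrow> Rs g x \<zero>\<^bsub>V x\<^esub> = \<zero>\<^bsub>V (\<psi> g x)\<^esub>"
  by (intro lin_maps_zero[OF _ _ Rs_lin] V_module) auto

text \<open>Right translations reverse the order and so do inverses:
  \<open>inv h \<otimes> inv g = inv (g \<otimes> h)\<close>. The two reversals cancel, so transport
  behaves like a left action.\<close>

lemma Rs_mult:
  assumes g: "g \<in> carrier G" and h: "h \<in> carrier G" and x: "x \<in> S" and l: "l \<in> carrier (V x)"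
  shows "Rs g (\<psi> h x) (Rs h x l) = Rs (g \<otimes> h) x l"
proof -
  have "Rs g (\<psi> h x) (Rs h x l) = mor_by (st x) (st (\<psi> g (\<psi> h x))) (inv h \<otimes> inv g) l"
    unfolding R_star_def Let_def
    by (rule mor_by_comp)
      (use g h x l st_conj[OF h x] st_conj[OF g act_closed[OF h x]] in \<open>simp_all add: st_subgroup\<close>)
  then show ?thesis
    using g h x by (simp add: R_star_def Let_def act_mult inv_mult_group)
qed

lemma Rs_stab:
  assumes h: "h \<in> st x" and x: "x \<in> S" and l: "l \<in> carrier (V x)"
  shows "Rs h x l = l"
proof -
  have "inv h \<in> st x" by (rule subgroup.m_inv_closed[OF st_subgroup[OF x] h])
  then have "mor_by (st x) (st x) (inv h) l = l" by (rule mor_by_id[OF st_subgroup[OF x] _ l])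
  moreover have "\<psi> h x = x" using h by (simp add: st_iff)
  ultimately show ?thesis by (simp add: R_star_def Let_def)
qed

text \<open>\<open>g\<close> and \<open>h\<close> differ by \<open>inv h \<otimes> g\<close>, which
  lies in the isotropy group and hence acts trivially on \<open>V x\<close>. The coset
  representatives picked inside \<open>F_gamma\<close> thus do not matter.\<close>

lemma Rs_cong:
  assumes g: "g \<in> carrier G" and h: "h \<in> carrier G" and x: "x \<in> S" and eq: "\<psi> g x = \<psi> h x"
    and l: "l \<in> carrier (V x)"
  shows "Rs g x l = Rs h x l"
proof -
  let ?k = "inv h \<otimes> g"
  have k: "?k \<in> st x" using g h x eq by (simp add: st_iff act_mult)
  have kG: "?k \<in> carrier G" and gk: "h \<otimes> ?k = g" using g h by (simp_all add: m_assoc[symmetric])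
  have "Rs g x l = Rs h (\<psi> ?k x) (Rs ?k x l)"
    using Rs_mult[OF h kG x l] gk by simp
  also have "\<dots> = Rs h x l"
    using Rs_stab[OF k x l] k by (simp add: st_iff)
  finally show ?thesis .
qed

section \<open>The modules F and F^G\<close>

lemma F_direct_sum:
  "F = (direct_sum S V)\<lparr>carrier := {u \<in> carrier (direct_sum S V). u s0 = \<zero>\<^bsub>V s0\<^esub>}\<rparr>"
  by (auto simp: F_mod_def direct_sum_def Let_def)

lemma F_module: "Module.module R F"
proof -
  have D: "Module.module R (direct_sum S V)"
    by (rule direct_sum_module[OF cring_R V_module])
  \<comment> \<open>\<open>F\<close> is the kernel of evaluation at the base point, so it inherits
    its module laws from the direct sum.\<close>
  have "(\<lambda>u. u s0) \<in> lin_maps R (direct_sum S V) (V s0)"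
    using base by (intro lin_mapsI) (auto simp: direct_sum_def)
  then have "submodule {u \<in> carrier (direct_sum S V). u s0 = \<zero>\<^bsub>V s0\<^esub>} R (direct_sum S V)"
    by (rule lin_maps_kernel_submodule[OF D V_module[OF base]])
  then show ?thesis
    unfolding F_direct_sum by (rule submodule.submodule_is_module[OF _ D])
qed

lemma F_carrier_iff: "u \<in> carrier F \<longleftrightarrow>
    u \<in> extensional S \<and> (\<forall>x\<in>S. u x \<in> carrier (V x)) \<and> u s0 = \<zero>\<^bsub>V s0\<^esub> \<and>
    finite {x \<in> S. u x \<noteq> \<zero>\<^bsub>V x\<^esub>}"
  by (auto simp: F_mod_def Let_def PiE_iff)

lemma F_simps:
  "x \<in> S \<Longrightarrow> (u \<oplus>\<^bsub>F\<^esub> v) x = u x \<oplus>\<^bsub>V x\<^esub> v x"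
  "x \<in> S \<Longrightarrow> \<zero>\<^bsub>F\<^esub> x = \<zero>\<^bsub>V x\<^esub>"
  "x \<in> S \<Longrightarrow> (r \<odot>\<^bsub>F\<^esub> u) x = r \<odot>\<^bsub>V x\<^esub> u x"
  by (simp_all add: F_mod_def Let_def)

text \<open>Evaluating at \<open>\<psi> g x\<close> removes the inverse from the action. In this
  form an invariant function is visibly determined on an orbit by its value at one point.\<close>

lemma F_act_fixed_iff:
  assumes "u \<in> carrier F"
  shows "(\<forall>g\<in>carrier G. F_act G M S \<psi> g u = u) \<longleftrightarrow>
    (\<forall>g\<in>carrier G. \<forall>x\<in>S. u (\<psi> g x) = Rs g x (u x))"
proof safe
  fix g x assume fixed: "\<forall>g\<in>carrier G. F_act G M S \<psi> g u = u" and gx: "g \<in> carrier G" "x \<in> S"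
  then have "u (\<psi> g x) = F_act G M S \<psi> g u (\<psi> g x)" by simp
  also have "\<dots> = Rs g x (u x)" using gx by (simp add: F_act_def)
  finally show "u (\<psi> g x) = Rs g x (u x)" .
next
  fix g assume fixed: "\<forall>g\<in>carrier G. \<forall>x\<in>S. u (\<psi> g x) = Rs g x (u x)" and g: "g \<in> carrier G"
  show "F_act G M S \<psi> g u = u"
  proof (rule extensionalityI[of _ S])
    fix y assume y: "y \<in> S"
    then have "u y = u (\<psi> g (\<psi> (inv g) y))" using g by simp
    also have "\<dots> = Rs g (\<psi> (inv g) y) (u (\<psi> (inv g) y))"
      by (rule fixed[rule_format]) (use g y in simp_all)
    finally show "F_act G M S \<psi> g u y = u y" using y by (simp add: F_act_def)
  qed (use assms in \<open>auto simp: F_act_def F_carrier_iff\<close>)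
qed

lemma FG_carrier: "carrier FG =
    {u \<in> carrier F. \<forall>g\<in>carrier G. \<forall>x\<in>S. u (\<psi> g x) = Rs g x (u x)}"
  unfolding FG_mod_def using F_act_fixed_iff by auto

lemma FG_simps:
  "x \<in> S \<Longrightarrow> (u \<oplus>\<^bsub>FG\<^esub> v) x = u x \<oplus>\<^bsub>V x\<^esub> v x"
  "x \<in> S \<Longrightarrow> \<zero>\<^bsub>FG\<^esub> x = \<zero>\<^bsub>V x\<^esub>"
  "x \<in> S \<Longrightarrow> (r \<odot>\<^bsub>FG\<^esub> u) x = r \<odot>\<^bsub>V x\<^esub> u x"
  by (simp_all add: FG_mod_def F_simps)

lemma F_closed: "u \<in> carrier F \<Longrightarrow> x \<in> S \<Longrightarrow> u x \<in> carrier (V x)"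
  by (simp add: F_carrier_iff)

lemma FG_closed: "u \<in> carrier FG \<Longrightarrow> x \<in> S \<Longrightarrow> u x \<in> carrier (V x)"
  by (simp add: F_carrier_iff FG_carrier)

lemma F_eval: "x \<in> S \<Longrightarrow> (\<lambda>u. u x) \<in> lin_maps R F (V x)"
  by (intro lin_mapsI) (auto simp: F_simps F_closed)

lemma FG_submodule: "submodule (carrier FG) R F"
proof -
  interpret F: Module.module R F by (rule F_module)
  show ?thesis
  proof (rule F.submoduleI)
    show "carrier FG \<subseteq> carrier F" by (auto simp: FG_carrier)
    show "\<zero>\<^bsub>F\<^esub> \<in> carrier FG" by (auto simp: FG_carrier F_simps Rs_zero)
  next
    fix u assume u: "u \<in> carrier FG"
    have neg: "(\<ominus>\<^bsub>F\<^esub> u) x = \<ominus>\<^bsub>V x\<^esub> u x" if "x \<in> S" for x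
      using lin_maps_neg[OF F_module V_module F_eval] that u by (simp add: FG_carrier)
    have "Rs g x (\<ominus>\<^bsub>V x\<^esub> u x) = \<ominus>\<^bsub>V (\<psi> g x)\<^esub> Rs g x (u x)" if "x \<in> S" "g \<in> carrier G" for g x
      using that FG_closed[OF u] by (intro lin_maps_neg[OF _ _ Rs_lin] V_module) auto
    then show "\<ominus>\<^bsub>F\<^esub> u \<in> carrier FG" using u by (auto simp: FG_carrier neg)
  next
    fix u v assume "u \<in> carrier FG" "v \<in> carrier FG"
    then show "u \<oplus>\<^bsub>F\<^esub> v \<in> carrier FG"
      by (auto simp: FG_carrier F_simps lin_maps_add[OF Rs_lin] F_closed)
  next
    fix r u assume "r \<in> carrier R" "u \<in> carrier FG"
    then show "r \<odot>\<^bsub>F\<^esub> u \<in> carrier FG"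
      by (auto simp: FG_carrier F_simps lin_maps_smult[OF Rs_lin] F_closed)
  qed
qed

lemma FG_module: "Module.module R FG"
  using submodule.submodule_is_module[OF FG_submodule F_module]
  by (simp add: FG_mod_def)

lemma FG_eval: "x \<in> S \<Longrightarrow> (\<lambda>u. u x) \<in> lin_maps R FG (V x)"
  by (intro lin_mapsI) (auto simp: FG_simps FG_closed)

lemma FG_ext:
  assumes "u \<in> carrier FG" "v \<in> carrier FG" "\<And>x. x \<in> S \<Longrightarrow> u x = v x"
  shows "u = v"
  using assms by (intro extensionalityI[of _ S]) (auto simp: FG_carrier F_carrier_iff)

section \<open>The generators of F^G\<close>

lemma F_single_closed:
  assumes "x \<in> S" "l \<in> carrier (V x)"
  shows "F_single G M S \<psi> s0 l x \<in> carrier F"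
proof -
  have "{y \<in> S. F_single G M S \<psi> s0 l x y \<noteq> \<zero>\<^bsub>V y\<^esub>} \<subseteq> {x}"
    by (auto simp: F_single_def)
  then have "finite {y \<in> S. F_single G M S \<psi> s0 l x y \<noteq> \<zero>\<^bsub>V y\<^esub>}"
    by (rule finite_subset) simp
  then show ?thesis using assms base unfolding F_carrier_iff by (auto simp: F_single_def)
qed

lemma finite_lcosets: "finite (lcosets H)"
  using finite_group by (auto simp: LCOSETS_def)

lemma coset_rep:
  assumes "x \<in> S" "C \<in> lcosets (st x)"
  shows "(SOME g. g \<in> C) \<in> carrier G" "(SOME g. g \<in> C) <# st x = C"
proof -
  interpret H: subgroup "st x" G by (rule st_subgroup) fact
  obtain a where a: "a \<in> carrier G" "C = a <# st x" using assms(2) by (auto simp: lcosets_iff)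
  have "a \<in> C" using a lcos_self[OF _ st_subgroup[OF assms(1)]] by simp
  then have C: "(SOME g. g \<in> C) \<in> C" by (rule someI)
  then show "(SOME g. g \<in> C) \<in> carrier G"
    using a l_coset_carrier[OF _ a(1) st_subgroup[OF assms(1)]] by simp
  show "(SOME g. g \<in> C) <# st x = C"
    using C a l_repr_independence[OF _ a(1) st_subgroup[OF assms(1)]] by simp
qed

lemma coset_eq_iff:
  assumes "x \<in> S" "g \<in> carrier G" "h \<in> carrier G"
  shows "g <# st x = h <# st x \<longleftrightarrow> \<psi> g x = \<psi> h x"
proof
  assume "g <# st x = h <# st x"
  then have "g \<in> h <# st x" using lcos_self[OF assms(2) st_subgroup[OF assms(1)]] by simp
  then obtain k where "k \<in> st x" "g = h \<otimes> k" by (auto simp: l_coset_def)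
  then show "\<psi> g x = \<psi> h x" using assms by (simp add: st_iff act_mult)
next
  assume "\<psi> g x = \<psi> h x"
  then have "\<psi> (inv g) (\<psi> h x) = x" using assms by (metis act_inv(1))
  then show "g <# st x = h <# st x"
    using assms by (intro l_coset_eqI st_subgroup) (simp_all add: st_iff act_mult)
qed

lemma gamma_summand:
  assumes "x \<in> S" "l \<in> carrier (V x)"
  shows "(\<lambda>C. let g = (SOME g. g \<in> C) in F_single G M S \<psi> s0 (Rs g x l) (\<psi> g x))
    \<in> lcosets (st x) \<rightarrow> carrier F"
  using assms coset_rep by (auto simp: Let_def intro!: F_single_closed Rs_closed)

lemma gamma_in_F:
  assumes "x \<in> S" "l \<in> carrier (V x)"
  shows "\<gamma> x l \<in> carrier F"
proof -
  interpret F: Module.module R F by (rule F_module)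
  show ?thesis unfolding F_gamma_def by (rule F.finsum_closed[OF gamma_summand[OF assms]])
qed

lemma gamma_eval:
  assumes x: "x \<in> S" and l: "l \<in> carrier (V x)" and y: "y \<in> S"
  shows "\<gamma> x l y = (\<Oplus>\<^bsub>V y\<^esub> C\<in>lcosets (st x).
    let g = (SOME g. g \<in> C) in F_single G M S \<psi> s0 (Rs g x l) (\<psi> g x) y)"
  unfolding F_gamma_def
  using lin_maps_finsum[OF F_module V_module[OF y] F_eval[OF y] finite_lcosets gamma_summand[OF x l]]
  by (simp add: Let_def)

text \<open>Cosets of the isotropy group correspond to points of the orbit, so exactly one summand
  is supported at \<open>\<psi> g x\<close>. Its chosen representative may differ from
  \<open>g\<close>, which \<open>Rs_cong\<close> absorbs. At the base point all summands are zero by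
  convention, hence \<open>x \<noteq> s0\<close>.\<close>

lemma gamma_orbit:
  assumes x: "x \<in> S" and l: "l \<in> carrier (V x)" and "x \<noteq> s0" and g: "g \<in> carrier G"
  shows "\<gamma> x l (\<psi> g x) = Rs g x l"
proof -
  let ?y = "\<psi> g x"
  let ?rep = "\<lambda>C. (SOME g. g \<in> C)"
  have y: "?y \<in> S" using x g by simp
  interpret V: Module.module R "V ?y" by (rule V_module[OF y])
  have C0: "g <# st x \<in> lcosets (st x)" using g by (auto simp: lcosets_iff)
  have eq: "F_single G M S \<psi> s0 (Rs (?rep C) x l) (\<psi> (?rep C) x) ?y
      = (if g <# st x = C then Rs g x l else \<zero>\<^bsub>V ?y\<^esub>)" if C: "C \<in> lcosets (st x)" for C
  proof -
    note rep = coset_rep[OF x C]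
    have iff: "g <# st x = C \<longleftrightarrow> \<psi> g x = \<psi> (?rep C) x"
      using coset_eq_iff[OF x g rep(1)] rep(2) by simp
    have "\<psi> (?rep C) x \<noteq> s0" using act_eq_base[OF rep(1) x] assms(3) by simp
    then show ?thesis
      using y iff Rs_cong[OF rep(1) g x _ l] by (auto simp: F_single_def)
  qed
  have "\<gamma> x l ?y = (\<Oplus>\<^bsub>V ?y\<^esub> C\<in>lcosets (st x). if g <# st x = C then Rs g x l else \<zero>\<^bsub>V ?y\<^esub>)"
    unfolding gamma_eval[OF x l y] Let_def
    by (rule V.finsum_cong') (use eq Rs_closed[OF g x l] in auto)
  also have "\<dots> = Rs g x l"
    using V.add.finprod_singleton[OF C0 finite_lcosets, of "\<lambda>_. Rs g x l"] Rs_closed[OF g x l]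
    by simp
  finally show ?thesis .
qed

lemma gamma_off_orbit:
  assumes x: "x \<in> S" and l: "l \<in> carrier (V x)" and y: "y \<in> S" and "y \<notin> orbit G \<psi> x"
  shows "\<gamma> x l y = \<zero>\<^bsub>V y\<^esub>"
proof -
  interpret V: Module.module R "V y" by (rule V_module[OF y])
  have "\<gamma> x l y = (\<Oplus>\<^bsub>V y\<^esub> C\<in>lcosets (st x). \<zero>\<^bsub>V y\<^esub>)"
    unfolding gamma_eval[OF x l y] Let_def
    by (rule V.finsum_cong') (use assms(4) coset_rep[OF x] y in \<open>auto simp: F_single_def orbit_def\<close>)
  then show ?thesis by simp
qed

lemma gamma_base:
  assumes l: "l \<in> carrier (V s0)"
  shows "\<gamma> s0 l = \<zero>\<^bsub>F\<^esub>"
proof (rule extensionalityI[of _ S])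
  show "\<gamma> s0 l \<in> extensional S" using gamma_in_F[OF base l] by (simp add: F_carrier_iff)
  show "\<zero>\<^bsub>F\<^esub> \<in> extensional S" by (simp add: F_mod_def Let_def)
  fix y assume y: "y \<in> S"
  interpret V: Module.module R "V y" by (rule V_module[OF y])
  have "\<gamma> s0 l y = (\<Oplus>\<^bsub>V y\<^esub> C\<in>lcosets (st s0). \<zero>\<^bsub>V y\<^esub>)"
    unfolding gamma_eval[OF base l y] Let_def
    by (rule V.finsum_cong') (use coset_rep[OF base] y in \<open>auto simp: F_single_def base_fixed\<close>)
  then show "\<gamma> s0 l y = \<zero>\<^bsub>F\<^esub> y" using y by (simp add: F_simps)
qed

lemma in_orbit_iff: "y \<in> orbit G \<psi> x \<longleftrightarrow> (\<exists>g\<in>carrier G. y = \<psi> g x)"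
  by (auto simp: orbit_def)

lemma gamma_in:
  assumes x: "x \<in> S" and l: "l \<in> carrier (V x)"
  shows "\<gamma> x l \<in> carrier FG"
proof (cases "x = s0")
  case True
  then show ?thesis
    using gamma_base l submodule.axioms(1)[OF FG_submodule] subgroup.one_closed by fastforce
next
  case False
  have "\<gamma> x l (\<psi> g y) = Rs g y (\<gamma> x l y)" if g: "g \<in> carrier G" and y: "y \<in> S" for g y
  proof (cases "y \<in> orbit G \<psi> x")
    case True
    then obtain h where h: "h \<in> carrier G" "y = \<psi> h x" by (auto simp: in_orbit_iff)
    have "\<gamma> x l (\<psi> g y) = \<gamma> x l (\<psi> (g \<otimes> h) x)" using g h x by (simp add: act_mult)
    also have "\<dots> = Rs (g \<otimes> h) x l" using g h by (intro gamma_orbit[OF x l False]) auto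
    finally show ?thesis
      using gamma_orbit[OF x l False h(1)] Rs_mult[OF g h(1) x l] h(2) by simp
  next
    case n: False
    have "\<psi> g y \<notin> orbit G \<psi> x"
    proof
      assume "\<psi> g y \<in> orbit G \<psi> x"
      then obtain h where h: "h \<in> carrier G" "\<psi> g y = \<psi> h x" by (auto simp: in_orbit_iff)
      then have "y = \<psi> (inv g \<otimes> h) x" using g y x by (metis act_inv(1) act_mult inv_closed)
      then show False using n g h by (auto simp: in_orbit_iff)
    qed
    then show ?thesis using n g y x l by (simp add: gamma_off_orbit Rs_zero)
  qed
  then show ?thesis using gamma_in_F[OF x l] by (simp add: FG_carrier)
qed

text \<open>A generator can be named from any point of its orbit. This is the relation that values
  prescribed on generators have to respect.\<close>

lemma gamma_act:
  assumes x: "x \<in> S" and l: "l \<in> carrier (V x)" and g: "g \<in> carrier G"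
  shows "\<gamma> (\<psi> g x) (Rs g x l) = \<gamma> x l"
proof (cases "x = s0")
  case True
  then show ?thesis using gamma_base Rs_closed[OF g x l] l g by (simp add: base_fixed)
next
  case False
  have gx: "\<psi> g x \<in> S" "Rs g x l \<in> carrier (V (\<psi> g x))" "\<psi> g x \<noteq> s0"
    using x g False Rs_closed[OF g x l] by (auto simp: act_eq_base)
  show ?thesis
  proof (rule FG_ext[OF gamma_in[OF gx(1,2)] gamma_in[OF x l]])
    fix y assume y: "y \<in> S"
    show "\<gamma> (\<psi> g x) (Rs g x l) y = \<gamma> x l y"
    proof (cases "y \<in> orbit G \<psi> x")
      case True
      then obtain h where h: "h \<in> carrier G" "y = \<psi> h x" by (auto simp: in_orbit_iff)
      have y': "y = \<psi> (h \<otimes> inv g) (\<psi> g x)" using h g x by (simp add: act_mult)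
      have "\<gamma> (\<psi> g x) (Rs g x l) y = Rs (h \<otimes> inv g) (\<psi> g x) (Rs g x l)"
        unfolding y' using h g by (intro gamma_orbit[OF gx]) auto
      also have "\<dots> = Rs h x l" using h g x l by (simp add: Rs_mult m_assoc)
      finally show ?thesis using gamma_orbit[OF x l False h(1)] h(2) by simp
    next
      case n: False
      have "y \<notin> orbit G \<psi> (\<psi> g x)"
        using n g x by (auto simp: in_orbit_iff simp flip: act_mult)
      then show ?thesis using n gx x l y by (simp add: gamma_off_orbit)
    qed
  qed
qed

lemma gamma_lin:
  assumes x: "x \<in> S"
  shows "\<gamma> x \<in> lin_maps R (V x) FG"
proof -
  interpret Vx: Module.module R "V x" by (rule V_module[OF x])
  interpret FG: Module.module R FG by (rule FG_module)
  show ?thesis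
  proof (cases "x = s0")
    case True
    have "\<gamma> x l = \<zero>\<^bsub>FG\<^esub>" if "l \<in> carrier (V x)" for l
      using gamma_base that True by (simp add: FG_mod_def)
    then show ?thesis by (intro lin_mapsI) auto
  next
    case False
    show ?thesis
    proof (rule lin_mapsI)
      fix l m assume lm: "l \<in> carrier (V x)" "m \<in> carrier (V x)"
      show "\<gamma> x (l \<oplus>\<^bsub>V x\<^esub> m) = \<gamma> x l \<oplus>\<^bsub>FG\<^esub> \<gamma> x m"
      proof (rule FG_ext)
        fix y assume y: "y \<in> S"
        interpret Vy: Module.module R "V y" by (rule V_module[OF y])
        show "\<gamma> x (l \<oplus>\<^bsub>V x\<^esub> m) y = (\<gamma> x l \<oplus>\<^bsub>FG\<^esub> \<gamma> x m) y"
        proof (cases "y \<in> orbit G \<psi> x")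
          case True
          then obtain g where "g \<in> carrier G" "y = \<psi> g x" by (auto simp: in_orbit_iff)
          then show ?thesis
            using x lm False by (simp add: FG_simps gamma_orbit lin_maps_add[OF Rs_lin])
        qed (use x lm y in \<open>simp add: FG_simps gamma_off_orbit\<close>)
      qed (use x lm in \<open>auto intro!: FG.add.m_closed gamma_in\<close>)
    next
      fix r l assume rl: "r \<in> carrier R" "l \<in> carrier (V x)"
      show "\<gamma> x (r \<odot>\<^bsub>V x\<^esub> l) = r \<odot>\<^bsub>FG\<^esub> \<gamma> x l"
      proof (rule FG_ext)
        fix y assume y: "y \<in> S"
        interpret Vy: Module.module R "V y" by (rule V_module[OF y])
        show "\<gamma> x (r \<odot>\<^bsub>V x\<^esub> l) y = (r \<odot>\<^bsub>FG\<^esub> \<gamma> x l) y"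
        proof (cases "y \<in> orbit G \<psi> x")
          case True
          then obtain g where "g \<in> carrier G" "y = \<psi> g x" by (auto simp: in_orbit_iff)
          then show ?thesis
            using x rl False by (simp add: FG_simps gamma_orbit lin_maps_smult[OF Rs_lin])
        qed (use x rl y in \<open>simp add: FG_simps gamma_off_orbit\<close>)
      qed (use x rl in \<open>auto intro!: FG.smult_closed gamma_in\<close>)
    qed (rule gamma_in[OF x])
  qed
qed

section \<open>Linear maps out of F^G: uniqueness and existence\<close>

lemma FG_generated:
  assumes N: "submodule N R FG"
    and gens: "\<And>x l. x \<in> S \<Longrightarrow> x \<noteq> s0 \<Longrightarrow> l \<in> carrier (V x) \<Longrightarrow> \<gamma> x l \<in> N"
    and u: "u \<in> carrier FG"
  shows "u \<in> N"
  using u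
proof (induction "card {x \<in> S. u x \<noteq> \<zero>\<^bsub>V x\<^esub>}" arbitrary: u rule: less_induct)
  case less
  interpret FG: Module.module R FG by (rule FG_module)
  interpret N: submodule N R FG by (rule N)
  note u = less.prems
  have fin: "finite {x \<in> S. u x \<noteq> \<zero>\<^bsub>V x\<^esub>}" using u by (simp add: FG_carrier F_carrier_iff)
  show ?case
  proof (cases "\<exists>x\<in>S. u x \<noteq> \<zero>\<^bsub>V x\<^esub>")
    case False
    then have "u = \<zero>\<^bsub>FG\<^esub>" using u by (intro FG_ext) (auto simp: FG_simps)
    then show ?thesis using N.one_closed by simp
  next
    case True
    then obtain x where x: "x \<in> S" "u x \<noteq> \<zero>\<^bsub>V x\<^esub>" by blast
    then have x0: "x \<noteq> s0" using u by (auto simp: FG_carrier F_carrier_iff)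
    have l: "u x \<in> carrier (V x)" using FG_closed[OF u x(1)] .
    note g = gamma_in[OF x(1) l]
    \<comment> \<open>By invariance, \<open>\<gamma> x (u x)\<close> agrees with \<open>u\<close> on
      the whole orbit of \<open>x\<close> and vanishes elsewhere. Subtracting it clears that orbit
      and leaves the other values alone, so the support shrinks strictly.\<close>
    define v where "v = u \<ominus>\<^bsub>FG\<^esub> \<gamma> x (u x)"
    have v: "v \<in> carrier FG" using u g by (simp add: v_def a_minus_def)
    have vy: "v y = u y \<ominus>\<^bsub>V y\<^esub> \<gamma> x (u x) y" if "y \<in> S" for y
      unfolding v_def using lin_maps_diff[OF FG_module V_module[OF that] FG_eval[OF that] u g] .
    have zero: "v y = \<zero>\<^bsub>V y\<^esub>" if y: "y \<in> S" and "y \<in> orbit G \<psi> x \<or> u y = \<zero>\<^bsub>V y\<^esub>" for y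
    proof -
      interpret Vy: Module.module R "V y" by (rule V_module[OF y])
      show ?thesis
      proof (cases "y \<in> orbit G \<psi> x")
        case True
        then obtain h where h: "h \<in> carrier G" "y = \<psi> h x" by (auto simp: in_orbit_iff)
        then have "\<gamma> x (u x) y = u y"
          using gamma_orbit[OF x(1) l x0] u x(1) by (simp add: FG_carrier)
        then show ?thesis using vy[OF y] FG_closed[OF u y] by (simp add: a_minus_def Vy.r_neg)
      next
        case False
        then show ?thesis
          using that vy[OF y] gamma_off_orbit[OF x(1) l y] by (simp add: a_minus_def)
      qed
    qed
    have "{y \<in> S. v y \<noteq> \<zero>\<^bsub>V y\<^esub>} \<subset> {y \<in> S. u y \<noteq> \<zero>\<^bsub>V y\<^esub>}"
      using zero x group_action.orbit_refl[OF action] by blast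
    then have "v \<in> N" using less.hyps v fin by (meson psubset_card_mono)
    then have "v \<oplus>\<^bsub>FG\<^esub> \<gamma> x (u x) \<in> N" using gens[OF x(1) x0 l] N.m_closed by simp
    moreover have "v \<oplus>\<^bsub>FG\<^esub> \<gamma> x (u x) = u"
      using u g by (simp add: v_def a_minus_def FG.add.m_assoc FG.l_neg)
    ultimately show ?thesis by simp
  qed
qed

text \<open>The set where two linear maps agree is a submodule, so \<open>FG_generated\<close>
  applies. The base point is exempt because its generators are zero.\<close>

lemma lin_maps_FG_eqI:
  assumes B: "Module.module R B" and h: "h \<in> lin_maps R FG B" and k: "k \<in> lin_maps R FG B"
    and eq: "\<And>x l. x \<in> S \<Longrightarrow> x \<noteq> s0 \<Longrightarrow> l \<in> carrier (V x) \<Longrightarrow> h (\<gamma> x l) = k (\<gamma> x l)"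
    and u: "u \<in> carrier FG"
  shows "h u = k u"
proof -
  interpret FG: Module.module R FG by (rule FG_module)
  have "submodule {u \<in> carrier FG. h u = k u} R FG"
    by (rule FG.submoduleI)
      (auto simp: lin_maps_zero[OF FG_module B] lin_maps_neg[OF FG_module B] lin_maps_add[OF h]
        lin_maps_add[OF k] lin_maps_smult[OF h] lin_maps_smult[OF k] h k)
  then have "u \<in> {u \<in> carrier FG. h u = k u}"
    by (rule FG_generated) (use eq gamma_in u in auto)
  then show ?thesis by simp
qed

text \<open>The extension is the sum of \<open>lam x (u x)\<close> over one representative \<open>x\<close> of each orbit: summing
  over all of \<open>S\<close> would count the orbit of \<open>x\<close> with multiplicity.\<close>

lemma FG_extend:
  assumes B: "Module.module R B"
    and lam: "\<And>x. x \<in> S \<Longrightarrow> lam x \<in> lin_maps R (V x) B"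
    and compat: "\<And>g x l. g \<in> carrier G \<Longrightarrow> x \<in> S \<Longrightarrow> l \<in> carrier (V x)
      \<Longrightarrow> lam (\<psi> g x) (Rs g x l) = lam x l"
    and lam0: "\<And>l. l \<in> carrier (V s0) \<Longrightarrow> lam s0 l = \<zero>\<^bsub>B\<^esub>"
  shows "\<exists>L\<in>lin_maps R FG B. \<forall>x\<in>S. \<forall>l\<in>carrier (V x). L (\<gamma> x l) = lam x l"
proof -
  interpret FG: Module.module R FG by (rule FG_module)
  interpret B: Module.module R B by (rule B)
  \<comment> \<open>The choice is made from the orbit as a set, so all points of one orbit receive
    the same representative and \<open>T\<close> meets each orbit exactly once.\<close>
  define rep where "rep x = (SOME z. z \<in> orbit G \<psi> x)" for x
  define T where "T = {x \<in> S. rep x = x}"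
  define supp where "supp u = {x \<in> T. u x \<noteq> \<zero>\<^bsub>V x\<^esub>}" for u :: "'s \<Rightarrow> 'm"
  define L where "L u = (\<Oplus>\<^bsub>B\<^esub> x\<in>supp u. lam x (u x))" for u
  have lamz: "lam x \<zero>\<^bsub>V x\<^esub> = \<zero>\<^bsub>B\<^esub>" if "x \<in> S" for x
    by (rule lin_maps_zero[OF V_module[OF that] B lam[OF that]])
  have fin: "finite (supp u)" if "u \<in> carrier FG" for u
  proof -
    have "finite {x \<in> S. u x \<noteq> \<zero>\<^bsub>V x\<^esub>}" using that by (simp add: FG_carrier F_carrier_iff)
    then show ?thesis by (rule rev_finite_subset) (auto simp: supp_def T_def)
  qed
  have lamc: "(\<lambda>x. lam x (u x)) \<in> A \<rightarrow> carrier B" if "u \<in> carrier FG" "A \<subseteq> T" for u A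
    using that FG_closed lin_maps_closed[OF lam] by (auto simp: T_def)
  \<comment> \<open>Additivity compares sums over three different supports. Enlarging the index set
    within \<open>T\<close> adds only zeros, so all of them can be taken over a common finite
    set.\<close>
  have L_eq: "L u = (\<Oplus>\<^bsub>B\<^esub> x\<in>A. lam x (u x))"
    if u: "u \<in> carrier FG" and A: "finite A" "supp u \<subseteq> A" "A \<subseteq> T" for u A
  proof -
    have "lam i (u i) = \<zero>\<^bsub>B\<^esub>" if "i \<in> A - supp u" for i
    proof -
      have "u i = \<zero>\<^bsub>V i\<^esub>" "i \<in> S" using A that by (auto simp: supp_def T_def)
      then show ?thesis using lamz by simp
    qed
    then show ?thesis
      unfolding L_def
      by (rule B.add.finprod_mono_neutral_cong_left[OF A(1,2) _ refl lamc[OF u A(3)]])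
  qed
  have L: "L \<in> lin_maps R FG B"
  proof (rule lin_mapsI)
    fix u assume u: "u \<in> carrier FG"
    show "L u \<in> carrier B" unfolding L_def
      by (rule B.finsum_closed[OF lamc[OF u]]) (auto simp: supp_def)
    fix v assume v: "v \<in> carrier FG"
    let ?A = "supp u \<union> supp v \<union> supp (u \<oplus>\<^bsub>FG\<^esub> v)"
    have A: "finite ?A" "?A \<subseteq> T" using fin u v by (auto simp: supp_def)
    have "L (u \<oplus>\<^bsub>FG\<^esub> v) = (\<Oplus>\<^bsub>B\<^esub> x\<in>?A. lam x ((u \<oplus>\<^bsub>FG\<^esub> v) x))"
      using u v A by (intro L_eq) auto
    also have "\<dots> = (\<Oplus>\<^bsub>B\<^esub> x\<in>?A. lam x (u x) \<oplus>\<^bsub>B\<^esub> lam x (v x))"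
    proof (rule B.finsum_cong'[OF refl])
      show "(\<lambda>x. lam x (u x) \<oplus>\<^bsub>B\<^esub> lam x (v x)) \<in> ?A \<rightarrow> carrier B"
        using lamc[OF u A(2)] lamc[OF v A(2)] by (auto simp: Pi_iff)
      fix x assume "x \<in> ?A"
      then have "x \<in> S" using A(2) by (auto simp: T_def)
      then show "lam x ((u \<oplus>\<^bsub>FG\<^esub> v) x) = lam x (u x) \<oplus>\<^bsub>B\<^esub> lam x (v x)"
        using lin_maps_add[OF lam] u v FG_closed by (simp add: FG_simps)
    qed
    also have "\<dots> = (\<Oplus>\<^bsub>B\<^esub> x\<in>?A. lam x (u x)) \<oplus>\<^bsub>B\<^esub> (\<Oplus>\<^bsub>B\<^esub> x\<in>?A. lam x (v x))"
      using lamc[OF u A(2)] lamc[OF v A(2)] by (rule B.finsum_addf)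
    also have "\<dots> = L u \<oplus>\<^bsub>B\<^esub> L v" by (subst (1 2) L_eq[OF _ A(1) _ A(2)]) (use u v in auto)
    finally show "L (u \<oplus>\<^bsub>FG\<^esub> v) = L u \<oplus>\<^bsub>B\<^esub> L v" .
  next
    fix r u assume r: "r \<in> carrier R" and u: "u \<in> carrier FG"
    let ?A = "supp u \<union> supp (r \<odot>\<^bsub>FG\<^esub> u)"
    have A: "finite ?A" "?A \<subseteq> T" using fin u r by (auto simp: supp_def)
    have "L (r \<odot>\<^bsub>FG\<^esub> u) = (\<Oplus>\<^bsub>B\<^esub> x\<in>?A. lam x ((r \<odot>\<^bsub>FG\<^esub> u) x))"
      using u r A by (intro L_eq) auto
    also have "\<dots> = (\<Oplus>\<^bsub>B\<^esub> x\<in>?A. r \<odot>\<^bsub>B\<^esub> lam x (u x))"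
    proof (rule B.finsum_cong'[OF refl])
      show "(\<lambda>x. r \<odot>\<^bsub>B\<^esub> lam x (u x)) \<in> ?A \<rightarrow> carrier B"
        using lamc[OF u A(2)] r by (auto simp: Pi_iff)
      fix x assume "x \<in> ?A"
      then have "x \<in> S" using A(2) by (auto simp: T_def)
      then show "lam x ((r \<odot>\<^bsub>FG\<^esub> u) x) = r \<odot>\<^bsub>B\<^esub> lam x (u x)"
        using lin_maps_smult[OF lam] u r FG_closed by (simp add: FG_simps)
    qed
    also have "\<dots> = r \<odot>\<^bsub>B\<^esub> L u"
      using B.finsum_smult_ldistr[OF A(1) r lamc[OF u A(2)]] L_eq[OF u A(1) _ A(2)] by simp
    finally show "L (r \<odot>\<^bsub>FG\<^esub> u) = r \<odot>\<^bsub>B\<^esub> L u" .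
  qed
  have "L (\<gamma> x l) = lam x l" if x: "x \<in> S" and l: "l \<in> carrier (V x)" for x l
  proof (cases "x = s0")
    case True
    then have "\<gamma> x l = \<zero>\<^bsub>FG\<^esub>" using gamma_base l by (simp add: FG_mod_def)
    then show ?thesis using lin_maps_zero[OF FG_module B L] lam0 l True by simp
  next
    case False
    have "rep x \<in> orbit G \<psi> x"
      unfolding rep_def using group_action.orbit_refl[OF action x] by (rule someI)
    then obtain g where g: "g \<in> carrier G" "rep x = \<psi> g x" by (auto simp: in_orbit_iff)
    have orb: "orbit G \<psi> (\<psi> h x) = orbit G \<psi> x" if h: "h \<in> carrier G" for h
    proof (intro equalityI subsetI)
      fix y assume "y \<in> orbit G \<psi> (\<psi> h x)"
      then show "y \<in> orbit G \<psi> x"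
        using h x unfolding in_orbit_iff by (metis act_mult m_closed)
    next
      fix y assume "y \<in> orbit G \<psi> x"
      then obtain k where "k \<in> carrier G" "y = \<psi> k x" by (auto simp: in_orbit_iff)
      then have "y = \<psi> (k \<otimes> inv h) (\<psi> h x)" "k \<otimes> inv h \<in> carrier G"
        using h x by (simp_all add: act_mult)
      then show "y \<in> orbit G \<psi> (\<psi> h x)" unfolding in_orbit_iff by blast
    qed
    have repT: "\<psi> g x \<in> T" using g x orb[OF g(1)] by (simp add: T_def rep_def)
    have "y = \<psi> g x" if y: "y \<in> T" "y \<in> orbit G \<psi> x" for y
    proof -
      obtain h where h: "h \<in> carrier G" "y = \<psi> h x" using y(2) by (auto simp: in_orbit_iff)
      have "rep y = rep x" using orb[OF h(1)] h(2) by (simp add: rep_def)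
      then show ?thesis using y(1) g by (simp add: T_def)
    qed
    then have "supp (\<gamma> x l) \<subseteq> {\<psi> g x}"
      using gamma_off_orbit[OF x l] by (auto simp: supp_def T_def)
    then have "L (\<gamma> x l) = (\<Oplus>\<^bsub>B\<^esub> y\<in>{\<psi> g x}. lam y (\<gamma> x l y))"
      using repT by (intro L_eq gamma_in[OF x l]) auto
    also have "\<dots> = lam (\<psi> g x) (\<gamma> x l (\<psi> g x))"
      using lamc[OF gamma_in[OF x l], of "{\<psi> g x}"] repT by (simp add: B.finsum_insert)
    also have "\<dots> = lam x l" using gamma_orbit[OF x l False g(1)] compat[OF g(1) x l] by simp
    finally show ?thesis .
  qed
  with L show ?thesis by blast
qed

end

text \<open>A definite description says something only after existence and uniqueness are
  established: \<open>FG_extend\<close> gives the first, \<open>lin_maps_FG_eqI\<close> the second.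
  Requiring the map to be extensional pins down its values off the carrier.\<close>

lemma FG_map_spec:
  fixes G (structure)
  assumes S: "pointed_gset G R M S \<psi> s0" and T: "pointed_gset G R M T \<theta> t0"
    and f: "\<And>x. x \<in> S \<Longrightarrow> f x \<in> T"
    and equi: "\<And>g x. g \<in> carrier G \<Longrightarrow> x \<in> S \<Longrightarrow> f (\<psi> g x) = \<theta> g (f x)"
    and pt: "f s0 = t0"
  defines "h \<equiv> FG_map G R M S \<psi> s0 T \<theta> t0 f"
  shows "h \<in> lin_maps R (FG_mod G M S \<psi> s0) (FG_mod G M T \<theta> t0)"
    and "\<And>x l. x \<in> S \<Longrightarrow> l \<in> carrier (obj M (stabilizer G \<psi> x)) \<Longrightarrow>
      h (F_gamma G M S \<psi> s0 x l) = F_gamma G M T \<theta> t0 (f x)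
        (mor M (stabilizer G \<psi> x) (stabilizer G \<theta> (f x))
          (orbit_map G (stabilizer G \<psi> x) (stabilizer G \<theta> (f x)) \<one>) l)"
proof -
  interpret S: pointed_gset G R M S \<psi> s0 by fact
  interpret T: pointed_gset G R M T \<theta> t0 by fact
  let ?m = "\<lambda>x. S.mor_by (S.st x) (T.st (f x)) \<one>"
  let ?lam = "\<lambda>x l. T.\<gamma> (f x) (?m x l)"
  interpret SFG: Module.module R S.FG by (rule S.FG_module)
  have st: "S.st x \<subseteq> T.st (f x)" if "x \<in> S" for x
    using that equi by (fastforce simp: S.st_iff T.st_iff)
  have m_lin: "?m x \<in> lin_maps R (S.V x) (T.V (f x))" if x: "x \<in> S" for x
  proof (rule S.mor_by_lin[OF S.st_subgroup[OF x] T.st_subgroup[OF f[OF x]] S.one_closed])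
    fix k assume k: "k \<in> S.st x"
    then show "inv \<one> \<otimes> k \<otimes> \<one> \<in> T.st (f x)" using st[OF x] by (auto simp: S.st_iff)
  qed
  have lam_lin: "?lam x \<in> lin_maps R (S.V x) T.FG" if x: "x \<in> S" for x
    by (rule lin_maps_comp[OF m_lin[OF x] T.gamma_lin[OF f[OF x]]])
  have compat: "?lam (\<psi> g x) (S.Rs g x l) = ?lam x l"
    if g: "g \<in> carrier G" and x: "x \<in> S" and l: "l \<in> carrier (S.V x)" for g x l
  proof -
    have gx: "\<psi> g x \<in> S" "inv g \<in> carrier G" using g x by simp_all
    have m1: "inv \<one> \<otimes> k \<otimes> \<one> \<in> T.st (f y)" if "y \<in> S" "k \<in> S.st y" for y k
      using st[OF that(1)] that(2) by (auto simp: S.st_iff)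
    \<comment> \<open>Transport along \<open>g\<close> followed by projection, and projection
      followed by transport, are both given by right translation by \<open>inv g\<close>; they
      appear as \<open>inv g \<otimes> \<one>\<close> and
      \<open>\<one> \<otimes> inv g\<close>.\<close>
    have "?m (\<psi> g x) (S.Rs g x l) = S.mor_by (S.st x) (T.st (f (\<psi> g x))) (inv g \<otimes> \<one>) l"
      unfolding R_star_def Let_def
      by (rule S.mor_by_comp[OF S.st_subgroup[OF x] S.st_subgroup[OF gx(1)]
        T.st_subgroup[OF f[OF gx(1)]] gx(2) S.one_closed S.st_conj[OF g x] m1[OF gx(1)] l])
    moreover have "T.Rs g (f x) (?m x l) = S.mor_by (S.st x) (T.st (\<theta> g (f x))) (\<one> \<otimes> inv g) l"
      unfolding R_star_def Let_def
      by (rule S.mor_by_comp[OF S.st_subgroup[OF x] T.st_subgroup[OF f[OF x]]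
        T.st_subgroup[OF T.act_closed[OF g f[OF x]]] S.one_closed gx(2) m1[OF x]
        T.st_conj[OF g f[OF x]] l])
    ultimately have "?m (\<psi> g x) (S.Rs g x l) = T.Rs g (f x) (?m x l)"
      using equi g x by simp
    then show ?thesis
      using T.gamma_act[OF f[OF x] lin_maps_closed[OF m_lin[OF x] l] g] equi g x by simp
  qed
  have base: "?lam s0 l = \<zero>\<^bsub>T.FG\<^esub>" if "l \<in> carrier (S.V s0)" for l
    using T.gamma_base lin_maps_closed[OF m_lin[OF S.base] that] pt by (simp add: FG_mod_def)
  define P where "P h \<longleftrightarrow> h \<in> lin_maps R S.FG T.FG \<and> h \<in> extensional (carrier S.FG) \<and>
    (\<forall>x\<in>S. \<forall>l\<in>carrier (S.V x). h (S.\<gamma> x l) = ?lam x l)" for h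
  obtain L where L: "L \<in> lin_maps R S.FG T.FG" "\<forall>x\<in>S. \<forall>l\<in>carrier (S.V x). L (S.\<gamma> x l) = ?lam x l"
    using S.FG_extend[OF T.FG_module lam_lin compat base] by blast
  have "P (restrict L (carrier S.FG))"
    unfolding P_def using L S.gamma_in lin_maps_cong[OF S.FG_module L(1)] by auto
  moreover have "h = k" if "P h" "P k" for h k
  proof (rule extensionalityI)
    show "h \<in> extensional (carrier S.FG)" "k \<in> extensional (carrier S.FG)"
      using that by (auto simp: P_def)
    have hk: "h \<in> lin_maps R S.FG T.FG" "k \<in> lin_maps R S.FG T.FG"
      using that by (auto simp: P_def)
    show "h u = k u" if "u \<in> carrier S.FG" for u
      by (rule S.lin_maps_FG_eqI[OF T.FG_module hk _ that])
        (use \<open>P h\<close> \<open>P k\<close> in \<open>simp add: P_def\<close>)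
  qed
  ultimately have "P (THE h. P h)" by (metis theI)
  moreover have "h = (THE h. P h)"
    unfolding h_def FG_map_def P_def Let_def ..
  ultimately have "P h" by simp
  then show "h \<in> lin_maps R S.FG T.FG"
    and "\<And>x l. x \<in> S \<Longrightarrow> l \<in> carrier (S.V x) \<Longrightarrow> h (S.\<gamma> x l) = ?lam x l"
    unfolding P_def by auto
qed

section \<open>Fixed points of \<open>G\<close>-CW-complexes\<close>

text \<open>The disc is star-shaped about the origin: scaling by \<open>1 - t\<close> multiplies the
  sum of squares by \<open>(1 - t)^2\<close>, which is at most 1.\<close>

lemma path_connected_disc: "path_connected_space (disc n)"
proof -
  have "path_component_of (disc n) v (\<lambda>i. 0)" if v: "v \<in> topspace (disc n)" for v
  proof -
    let ?g = "\<lambda>t i. (1 - t) * v i"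
    have "continuous_map (top_of_set {0..1}) (powertop_real UNIV) ?g"
      unfolding continuous_map_componentwise by (force intro: continuous_intros)
    moreover have "?g t \<in> {x. \<forall>i\<ge>n. x i = 0}" "?g t \<in> {v. (\<Sum>i<n. (v i)\<^sup>2) \<le> 1}"
      if t: "t \<in> {0..1}" for t :: real
    proof -
      show "?g t \<in> {x. \<forall>i\<ge>n. x i = 0}"
        using v by (auto simp: disc_def topspace_Euclidean_space)
      have "(\<Sum>i<n. (?g t i)\<^sup>2) = (1 - t)\<^sup>2 * (\<Sum>i<n. (v i)\<^sup>2)"
        by (simp add: power_mult_distrib sum_distrib_left)
      also have "\<dots> \<le> 1 * 1"
        using t v by (intro mult_mono) (auto simp: disc_def power_le_one sum_nonneg)
      finally show "?g t \<in> {v. (\<Sum>i<n. (v i)\<^sup>2) \<le> 1}" by simp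
    qed
    ultimately have "pathin (disc n) ?g"
      unfolding pathin_def disc_def Euclidean_space_def continuous_map_in_subtopology by auto
    then show ?thesis unfolding path_component_of_def by force
  qed
  then show ?thesis
    unfolding path_connected_space_iff_path_component
    by (meson path_component_of_sym path_component_of_trans)
qed

lemma closedin_disc_boundary: "closedin (disc n) (disc_boundary n)"
proof -
  have "continuous_map (disc n) euclideanreal (\<lambda>v. \<Sum>i<n. (v i)\<^sup>2)"
    unfolding disc_def Euclidean_space_def
    by (intro continuous_map_from_subtopology continuous_intros
      continuous_map_product_projection) auto
  from closedin_continuous_map_preimage[OF this, of "{1}"]
  show ?thesis by (simp add: disc_boundary_def)
qed

text \<open>The orbit is discrete and finite, so a set is closed as soon as its slice over each
  coset is: it is a finite union of closed slices.\<close>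

lemma closedin_orbit_disc:
  assumes "finite (lcosets\<^bsub>G\<^esub> H)"
    and "\<And>C. C \<in> lcosets\<^bsub>G\<^esub> H \<Longrightarrow> closedin (disc n) {v \<in> topspace (disc n). (C, v) \<in> Z}"
  shows "closedin (orbit_disc G H n) {z \<in> topspace (orbit_disc G H n). z \<in> Z}"
proof -
  let ?S = "\<lambda>C. {C} \<times> {v \<in> topspace (disc n). (C, v) \<in> Z}"
  have "closedin (orbit_disc G H n) (\<Union> (?S ` (lcosets\<^bsub>G\<^esub> H)))"
    using assms by (intro closedin_Union) (auto simp: orbit_disc_def closedin_prod_Times_iff)
  moreover have "\<Union> (?S ` (lcosets\<^bsub>G\<^esub> H)) = {z \<in> topspace (orbit_disc G H n). z \<in> Z}"
    by (auto simp: orbit_disc_def)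
  ultimately show ?thesis by simp
qed

text \<open>An open cell that meets \<open>Y\<^sup>H\<close> lies in it together with its closure, so each closed cell is
  either contained in \<open>W\<close> or meets \<open>W\<close> only in its boundary.\<close>

lemma saturated_closed_attach:
  assumes G: "group G" "finite (carrier G)" and H: "subgroup H G"
    and attach: "attach_cells G Y \<theta> n A B cells" and B: "B \<subseteq> topspace Y"
    and W: "W \<subseteq> fixed_points Y \<theta> H"
    and sat: "\<And>x y. x \<in> W \<Longrightarrow> path_component_of (subtopology Y (fixed_points Y \<theta> H)) x y \<Longrightarrow> y \<in> W"
    and closed: "closedin (subtopology Y A) (W \<inter> A)"
  shows "closedin (subtopology Y B) (W \<inter> B)"
proof -
  interpret group G by fact
  let ?F = "fixed_points Y \<theta> H"
  have AB: "A \<subseteq> B" using attach by (simp add: attach_cells_def)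
  have weak: "closedin (subtopology Y B) (W \<inter> B)"
    if "\<forall>(K, \<Phi>)\<in>cells. closedin (orbit_disc G K n) {z \<in> topspace (orbit_disc G K n). \<Phi> z \<in> W \<inter> B}"
  proof -
    have all: "\<forall>W\<subseteq>B. closedin (subtopology Y A) (W \<inter> A) \<and>
        (\<forall>(H, \<Phi>)\<in>cells. closedin (orbit_disc G H n) {z \<in> topspace (orbit_disc G H n). \<Phi> z \<in> W}) \<longrightarrow>
        closedin (subtopology Y B) W"
      using attach unfolding attach_cells_def by (elim conjE)
    have "W \<inter> B \<inter> A = W \<inter> A" using AB by auto
    then show ?thesis using all[THEN spec, of "W \<inter> B"] closed that by simp
  qed
  have "closedin (orbit_disc G K n) {z \<in> topspace (orbit_disc G K n). \<Phi> z \<in> W \<inter> B}"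
    if cell: "(K, \<Phi>) \<in> cells" for K \<Phi>
  proof -
    note cellD = attach[unfolded attach_cells_def, THEN conjunct2, THEN conjunct1, THEN bspec, OF cell,
        unfolded prod.case]
    have K: "subgroup K G"
      and \<Phi>: "continuous_map (orbit_disc G K n) (subtopology Y B) \<Phi>"
      and equi: "\<And>g C v. g \<in> carrier G \<Longrightarrow> C \<in> lcosets\<^bsub>G\<^esub> K \<Longrightarrow> v \<in> topspace (disc n)
        \<Longrightarrow> \<Phi> (g <#\<^bsub>G\<^esub> C, v) = \<theta> g (\<Phi> (C, v))"
      and bd: "\<Phi> ` ((lcosets\<^bsub>G\<^esub> K) \<times> disc_boundary n) \<subseteq> A"
      using cellD by simp_all
    have inj: "inj_on (\<lambda>((H, \<Phi>), z). \<Phi> z)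
        (Sigma cells (\<lambda>(H, \<Phi>). (lcosets\<^bsub>G\<^esub> H) \<times> (topspace (disc n) - disc_boundary n)))"
      using attach[unfolded attach_cells_def, THEN conjunct2, THEN conjunct2, THEN conjunct1]
      by (rule bij_betw_imp_inj_on)
    have fin: "finite (lcosets\<^bsub>G\<^esub> K)" using G(2) by (auto simp: LCOSETS_def)
    have "closedin (disc n) {v \<in> topspace (disc n). (C, v) \<in> {z. \<Phi> z \<in> W \<inter> B}}"
      if C: "C \<in> lcosets\<^bsub>G\<^esub> K" for C
    proof -
      have cont: "continuous_map (disc n) (subtopology Y B) (\<lambda>v. \<Phi> (C, v))"
      proof -
        have "continuous_map (disc n) (orbit_disc G K n) (\<lambda>v. (C, v))"
          unfolding orbit_disc_def using C by (intro continuous_intros) auto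
        from continuous_map_compose[OF this \<Phi>] show ?thesis by (simp add: o_def)
      qed
      have mem: "\<Phi> (C, v) \<in> topspace Y \<and> \<Phi> (C, v) \<in> B" if "v \<in> topspace (disc n)" for v
        using continuous_map_image_subset_topspace[OF cont] that by auto
      show ?thesis
      proof (cases "\<exists>v\<in>topspace (disc n) - disc_boundary n. \<Phi> (C, v) \<in> W")
        case True
        then obtain v where v: "v \<in> topspace (disc n) - disc_boundary n" "\<Phi> (C, v) \<in> W" by blast
        \<comment> \<open>The point \<open>v\<close> is interior, and on interiors the
          characteristic maps are jointly injective. As \<open>h\<close> fixes the image of
          \<open>(C, v)\<close>, it must fix the coset \<open>C\<close> itself; by equivariance it
          then fixes the image of all of \<open>C \<times> D^n\<close>.\<close>
        have stab: "h <#\<^bsub>G\<^esub> C = C" if h: "h \<in> H" for h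
        proof -
          have hG: "h \<in> carrier G" using H h subgroup.mem_carrier by metis
          obtain a where a: "a \<in> carrier G" "C = a <#\<^bsub>G\<^esub> K" using C by (auto simp: lcosets_iff)
          have hC: "h <#\<^bsub>G\<^esub> C \<in> lcosets\<^bsub>G\<^esub> K"
            using a hG subgroup.subset[OF K] by (auto simp: lcosets_iff lcos_m_assoc intro!: bexI[of _ "h \<otimes>\<^bsub>G\<^esub> a"])
          have "\<Phi> (h <#\<^bsub>G\<^esub> C, v) = \<Phi> (C, v)"
            using equi[OF hG C] v W h by (auto simp: fixed_points_def)
          then have "((K, \<Phi>), (h <#\<^bsub>G\<^esub> C, v)) = ((K, \<Phi>), (C, v))"
            using cell hC C v by (intro inj_onD[OF inj]) auto
          then show ?thesis by simp
        qed
        have fixed: "\<Phi> (C, w) \<in> ?F" if w: "w \<in> topspace (disc n)" for w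
        proof -
          have "\<theta> h (\<Phi> (C, w)) = \<Phi> (C, w)" if h: "h \<in> H" for h
            using equi[OF _ C w, of h] stab[OF h] H h subgroup.mem_carrier by metis
          then show ?thesis using mem[OF w] by (simp add: fixed_points_def)
        qed
        have "continuous_map (disc n) (subtopology Y ?F) (\<lambda>v. \<Phi> (C, v))"
          using cont fixed by (auto simp: continuous_map_in_subtopology)
        \<comment> \<open>The image of the slice over \<open>C\<close> is path connected inside the
          fixed point set, so saturation pulls all of it into \<open>W\<close>.\<close>
        then have "path_component_of (subtopology Y ?F) (\<Phi> (C, v)) (\<Phi> (C, w))"
          if "w \<in> topspace (disc n)" for w
          using path_connected_space_imp_path_component_of[OF path_connected_disc, of v n w] v that
          by (intro path_component_of_continuous_image[where f = "\<lambda>v. \<Phi> (C, v)"]) auto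
        then have "\<Phi> (C, w) \<in> W" if "w \<in> topspace (disc n)" for w
          using sat[OF v(2)] that by blast
        then have "{v \<in> topspace (disc n). (C, v) \<in> {z. \<Phi> z \<in> W \<inter> B}} = topspace (disc n)"
          using mem by auto
        then show ?thesis by simp
      next
        case False
        let ?D = "subtopology (disc n) (disc_boundary n)"
        have bsub: "disc_boundary n \<subseteq> topspace (disc n)" by (auto simp: disc_boundary_def)
        \<comment> \<open>No interior point is mapped into \<open>W\<close>, so the preimage lies in
          the boundary. There the map lands in \<open>A\<close>, where closedness is already known,
          and the boundary is closed in the disc.\<close>
        have "continuous_map ?D (subtopology Y A) (\<lambda>v. \<Phi> (C, v))"
          using continuous_map_from_subtopology[OF cont, of "disc_boundary n"] bd C
          by (auto simp: continuous_map_in_subtopology)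
        from closedin_continuous_map_preimage[OF this closed]
        have "closedin ?D {v \<in> topspace ?D. \<Phi> (C, v) \<in> W \<inter> A}" .
        then have "closedin (disc n) {v \<in> topspace ?D. \<Phi> (C, v) \<in> W \<inter> A}"
          by (rule closedin_trans_full[OF _ closedin_disc_boundary])
        moreover have "{v \<in> topspace ?D. \<Phi> (C, v) \<in> W \<inter> A}
            = {v \<in> topspace (disc n). (C, v) \<in> {z. \<Phi> z \<in> W \<inter> B}}"
          using False bd C mem bsub by auto
        ultimately show ?thesis by simp
      qed
    qed
    from closedin_orbit_disc[OF fin this] show ?thesis by simp
  qed
  then show ?thesis by (intro weak) auto
qed

text \<open>Induction over the skeleta, assembled by the weak topology. The statement covers
  arbitrary unions of path components of Y^H, so it applies to a component and to its complement
  alike.\<close>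

lemma saturated_closed:
  assumes G: "group G" "finite (carrier G)" and H: "subgroup H G"
    and CW: "G_CW_complex G Y \<theta>"
    and W: "W \<subseteq> fixed_points Y \<theta> H"
    and sat: "\<And>x y. x \<in> W \<Longrightarrow> path_component_of (subtopology Y (fixed_points Y \<theta> H)) x y \<Longrightarrow> y \<in> W"
  shows "closedin Y W"
proof -
  obtain sk cells where sk: "(\<Union>n. sk n) = topspace Y"
    and attach: "\<And>n. attach_cells G Y \<theta> n (if n = 0 then {} else sk (n - 1)) (sk n) (cells n)"
    and weak: "\<And>W. W \<subseteq> topspace Y \<Longrightarrow> (\<And>n. closedin (subtopology Y (sk n)) (W \<inter> sk n)) \<Longrightarrow> closedin Y W"
    using CW unfolding G_CW_complex_def by (elim conjE exE) blast
  have sub: "sk n \<subseteq> topspace Y" for n using sk by auto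
  have step: "closedin (subtopology Y (sk n)) (W \<inter> sk n)"
    if "closedin (subtopology Y (if n = 0 then {} else sk (n - 1)))
      (W \<inter> (if n = 0 then {} else sk (n - 1)))" for n
    by (rule saturated_closed_attach[OF G H attach sub W _ that]) (fact sat)
  have "closedin (subtopology Y (sk n)) (W \<inter> sk n)" for n
  proof (induction n)
    case 0
    \<comment> \<open>The 0-skeleton is attached to the empty set, where the hypothesis of
      \<open>step\<close> is trivial.\<close>
    show ?case by (rule step) simp
  next
    case (Suc n)
    show ?case by (rule step) (use Suc in simp)
  qed
  then show ?thesis using W by (intro weak) (auto simp: fixed_points_def)
qed

text \<open>An equivariant map restricts to fixed points, so \<open>f\<close> and \<open>k\<close>
  compare X^H with Y^H. The path from \<open>x\<close> to \<open>y\<close> has three pieces: a track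
  of the homotopy from \<open>x\<close> to \<open>k (f x)\<close>, the image under \<open>k\<close>
  of a path in Y^H, and a track from \<open>k (f y)\<close> to \<open>y\<close>.\<close>

lemma fixed_points_path_connected:
  assumes G: "group G" "finite (carrier G)" and H: "subgroup H G"
    and CW: "G_CW_complex G Y \<theta>" and equiv: "G_homotopy_equivalent G X \<phi> Y \<theta>"
    and conn: "connectedin X (fixed_points X \<phi> H)"
    and x: "x \<in> fixed_points X \<phi> H" and y: "y \<in> fixed_points X \<phi> H"
  shows "path_component_of (subtopology X (fixed_points X \<phi> H)) x y"
proof -
  let ?E = "fixed_points X \<phi> H" and ?F = "fixed_points Y \<theta> H"
  have HG: "h \<in> carrier G" if "h \<in> H" for h using H that subgroup.mem_carrier by metis
  obtain f k where f: "continuous_map X Y f" "equivariant G X \<phi> \<theta> f"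
    and k: "continuous_map Y X k" "equivariant G Y \<theta> \<phi> k"
    and hom: "homotopic_with (equivariant G X \<phi> \<phi>) X X (k \<circ> f) id"
    using equiv unfolding G_homotopy_equivalent_def by blast
  have fE: "f z \<in> ?F" if "z \<in> ?E" for z
    using that f HG continuous_map_image_subset_topspace[OF f(1)]
    by (fastforce simp: fixed_points_def equivariant_def)
  have kF: "k z \<in> ?E" if "z \<in> ?F" for z
    using that k HG continuous_map_image_subset_topspace[OF k(1)]
    by (fastforce simp: fixed_points_def equivariant_def)
  let ?P = "path_component_of (subtopology Y ?F)"
  have Fsub: "?F \<subseteq> topspace Y" by (auto simp: fixed_points_def)
  have PF: "z \<in> ?F" if "?P a z" for a z
    using path_component_in_topspace[OF that] by auto
  \<comment> \<open>\<open>W\<close> and its complement in \<open>?F\<close> are both unions of path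
    components, hence both closed in \<open>Y\<close>. The connected image of \<open>?E\<close>
    meets \<open>W\<close> at \<open>f x\<close> and therefore cannot meet the complement.\<close>
  define W where "W = {z. ?P (f x) z}"
  have "closedin Y W"
    by (rule saturated_closed[OF G H CW])
      (use PF in \<open>auto simp: W_def intro: path_component_of_trans\<close>)
  moreover have "closedin Y (?F - W)"
    by (rule saturated_closed[OF G H CW])
      (use PF in \<open>auto simp: W_def intro: path_component_of_trans path_component_of_sym\<close>)
  moreover have "connectedin Y (f ` ?E)"
    by (rule connectedin_continuous_map_image[OF f(1) conn])
  moreover have "f ` ?E \<subseteq> W \<union> (?F - W)" using fE by auto
  moreover have "f x \<in> W \<inter> f ` ?E"
    using x fE[OF x] Fsub by (auto simp: W_def path_component_of_refl)
  ultimately have "(?F - W) \<inter> f ` ?E = {}"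
    unfolding connectedin_closedin by blast
  then have "?P (f x) (f y)" using y fE[OF y] by (auto simp: W_def)
  moreover have "continuous_map (subtopology Y ?F) (subtopology X ?E) k"
    using continuous_map_from_subtopology[OF k(1)] kF by (auto simp: continuous_map_in_subtopology)
  ultimately have middle: "path_component_of (subtopology X ?E) (k (f x)) (k (f y))"
    using path_component_of_continuous_image by metis
  obtain h where h: "continuous_map (prod_topology (top_of_set {0..1::real}) X) X h"
    "\<And>x. h (0, x) = k (f x)" "\<And>x. h (1, x) = x"
    "\<And>t. t \<in> {0..1} \<Longrightarrow> equivariant G X \<phi> \<phi> (\<lambda>x. h (t, x))"
    using hom unfolding homotopic_with_def by auto
  \<comment> \<open>Each stage of the homotopy is equivariant, so the track of a point fixed by
    \<open>H\<close> consists of points fixed by \<open>H\<close>.\<close>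
  have ends: "path_component_of (subtopology X ?E) (k (f z)) z" if z: "z \<in> ?E" for z
  proof -
    have zX: "z \<in> topspace X" using z by (simp add: fixed_points_def)
    have "continuous_map (top_of_set {0..1}) (prod_topology (top_of_set {0..1::real}) X) (\<lambda>t. (t, z))"
      using zX by (intro continuous_intros) auto
    from continuous_map_compose[OF this h(1)]
    have c: "continuous_map (top_of_set {0..1}) X (\<lambda>t. h (t, z))" by (simp add: o_def)
    have "h (t, z) \<in> ?E" if t: "t \<in> {0..1}" for t
      using h(4)[OF t] z zX HG t continuous_map_image_subset_topspace[OF c]
      by (fastforce simp: fixed_points_def equivariant_def)
    then have "pathin (subtopology X ?E) (\<lambda>t. h (t, z))"
      using c by (auto simp: pathin_def continuous_map_in_subtopology)
    then show ?thesis unfolding path_component_of_def using h(2,3) by force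
  qed
  show ?thesis
    using middle ends[OF x] ends[OF y] by (meson path_component_of_sym path_component_of_trans)
qed

section \<open>Singular simplices\<close>

text \<open>An action is a homomorphism into \<open>BijGroup E\<close>, whose elements are
  extensional bijections. This explains the condition \<open>ext\<close>; bijectivity follows from
  the inverse \<open>\<psi> (inv g)\<close>.\<close>

lemma group_actionI:
  fixes G (structure)
  assumes G: "group G"
    and closed: "\<And>g x. g \<in> carrier G \<Longrightarrow> x \<in> E \<Longrightarrow> \<psi> g x \<in> E"
    and ext: "\<And>g. g \<in> carrier G \<Longrightarrow> \<psi> g \<in> extensional E"
    and one: "\<And>x. x \<in> E \<Longrightarrow> \<psi> \<one> x = x"
    and mult: "\<And>g h x. g \<in> carrier G \<Longrightarrow> h \<in> carrier G \<Longrightarrow> x \<in> E \<Longrightarrow> \<psi> (g \<otimes> h) x = \<psi> g (\<psi> h x)"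
  shows "group_action G E \<psi>"
proof -
  interpret group G by fact
  have inv: "\<psi> (inv g) (\<psi> g x) = x" "\<psi> g (\<psi> (inv g) x) = x" if "g \<in> carrier G" "x \<in> E" for g x
    using that by (simp_all add: mult[symmetric] one)
  have Bij: "\<psi> g \<in> Bij E" if "g \<in> carrier G" for g
    using that closed ext inv by (auto simp: Bij_def intro!: bij_betwI[where g = "\<psi> (inv g)"])
  have "\<psi> (g \<otimes> h) = \<psi> g \<otimes>\<^bsub>BijGroup E\<^esub> \<psi> h" if "g \<in> carrier G" "h \<in> carrier G" for g h
    using that Bij ext mult
    by (intro extensionalityI[of _ E]) (auto simp: BijGroup_def compose_eq)
  then have "\<psi> \<in> hom G (BijGroup E)"
    using Bij by (auto simp: hom_def BijGroup_def)
  then show ?thesis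
    by (simp add: group_action_def group_hom_def group_hom_axioms_def group_BijGroup G)
qed

section \<open>Points as 0-simplices, end points of edges, and the action on simplices\<close>

lemma singular_simplex_image:
  "singular_simplex q Y \<sigma> \<Longrightarrow> v \<in> standard_simplex q \<Longrightarrow> \<sigma> v \<in> topspace Y"
  unfolding singular_simplex_def using continuous_map_image_subset_topspace by fastforce

lemma singular_simplex_const: "y \<in> topspace Y \<Longrightarrow> singular_simplex q Y (const_simplex q y)"
  unfolding singular_simplex_def const_simplex_def
  by (auto intro: continuous_map_eq[where f = "\<lambda>v. y"])

lemma const_simplex_inj [simp]: "const_simplex q y = const_simplex q z \<longleftrightarrow> y = z"
proof
  obtain v where "v \<in> standard_simplex q" using nonempty_standard_simplex by blast
  moreover assume "const_simplex q y = const_simplex q z"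
  ultimately show "y = z" unfolding const_simplex_def by (metis restrict_apply')
qed simp

lemma singular_simplex_0_iff:
  "singular_simplex 0 Y \<sigma> \<longleftrightarrow> (\<exists>y\<in>topspace Y. \<sigma> = const_simplex 0 y)"
proof
  let ?e = "\<lambda>j::nat. if j = 0 then 1 else 0 :: real"
  assume \<sigma>: "singular_simplex 0 Y \<sigma>"
  then have "\<sigma> = const_simplex 0 (\<sigma> ?e)"
    unfolding singular_simplex_def const_simplex_def standard_simplex_0
    by (intro extensionalityI[of _ "{?e}"]) auto
  moreover have "\<sigma> ?e \<in> topspace Y"
    by (rule singular_simplex_image[OF \<sigma>]) simp
  ultimately show "\<exists>y\<in>topspace Y. \<sigma> = const_simplex 0 y" by blast
qed (auto intro: singular_simplex_const)

text \<open>Face \<open>i\<close> omits vertex \<open>i\<close>, so face 0 is the value at vertex 1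
  and face 1 the value at vertex 0. This fixes the direction in which paths are traversed
  later.\<close>

lemma singular_face_1:
  "singular_face (Suc 0) 0 \<sigma> = const_simplex 0 (\<sigma> (\<lambda>j. if j = 1 then 1 else 0))"
  "singular_face (Suc 0) (Suc 0) \<sigma> = const_simplex 0 (\<sigma> (\<lambda>j. if j = 0 then 1 else 0))"
proof -
  have "simplical_face 0 (\<lambda>j. if j = 0 then 1 else 0 :: real) = (\<lambda>j. if j = 1 then 1 else 0)"
    "simplical_face (Suc 0) (\<lambda>j. if j = 0 then 1 else 0 :: real) = (\<lambda>j. if j = 0 then 1 else 0)"
    by (auto simp: simplical_face_def)
  then show "singular_face (Suc 0) 0 \<sigma> = const_simplex 0 (\<sigma> (\<lambda>j. if j = 1 then 1 else 0))"
    "singular_face (Suc 0) (Suc 0) \<sigma> = const_simplex 0 (\<sigma> (\<lambda>j. if j = 0 then 1 else 0))"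
    by (auto simp: singular_face_def const_simplex_def standard_simplex_0)
qed

lemma sing_act_simplex:
  assumes "G_space G Y \<phi>" "g \<in> carrier G" "singular_simplex q Y \<sigma>"
  shows "singular_simplex q Y (sing_act q Y \<phi> g \<sigma>)"
proof -
  have "continuous_map (subtopology (powertop_real UNIV) (standard_simplex q)) Y (\<phi> g \<circ> \<sigma>)"
    using assms by (auto simp: G_space_def singular_simplex_def intro: continuous_map_compose)
  then have "continuous_map (subtopology (powertop_real UNIV) (standard_simplex q)) Y
      (\<lambda>v\<in>standard_simplex q. \<phi> g (\<sigma> v))"
    by (rule continuous_map_eq) simp
  then show ?thesis using assms(3) by (simp add: sing_act_def singular_simplex_def)
qed

lemma sing_act_const:
  assumes "y \<in> topspace Y"
  shows "sing_act q Y \<phi> g (const_simplex q y) = const_simplex q (\<phi> g y)"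
  using singular_simplex_const[OF assms, of q]
  by (auto simp: sing_act_def const_simplex_def intro!: restrict_ext)

lemma sing_act_action:
  assumes Y: "G_space G Y \<phi>"
  shows "group_action G (singular_simplex_set q Y) (sing_act q Y \<phi>)"
proof -
  have act: "group_action G (topspace Y) \<phi>" using Y by (simp add: G_space_def)
  have G: "group G" using group_action.group_hom[OF act] group_hom.axioms(1) by blast
  interpret group G by fact
  have one: "\<phi> \<one>\<^bsub>G\<^esub> y = y" if "y \<in> topspace Y" for y
    using group_action.id_eq_one[OF act] that by (metis restrict_apply')
  show ?thesis
  proof (rule group_actionI[OF G])
    fix g h \<sigma> assume gh: "g \<in> carrier G" "h \<in> carrier G" and \<sigma>: "\<sigma> \<in> singular_simplex_set q Y"
    have "sing_act q Y \<phi> g (sing_act q Y \<phi> h \<sigma>)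
        = (\<lambda>v\<in>standard_simplex q. \<phi> g (sing_act q Y \<phi> h \<sigma> v))"
      using sing_act_simplex[OF Y gh(2)] \<sigma> by (simp add: sing_act_def[of _ _ _ g])
    also have "\<dots> = (\<lambda>v\<in>standard_simplex q. \<phi> (g \<otimes>\<^bsub>G\<^esub> h) (\<sigma> v))"
      using \<sigma> gh singular_simplex_image[of q Y \<sigma>]
      by (intro restrict_ext) (simp add: sing_act_def group_action.composition_rule[OF act])
    also have "\<dots> = sing_act q Y \<phi> (g \<otimes>\<^bsub>G\<^esub> h) \<sigma>" using \<sigma> by (simp add: sing_act_def)
    finally show "sing_act q Y \<phi> (g \<otimes>\<^bsub>G\<^esub> h) \<sigma> = sing_act q Y \<phi> g (sing_act q Y \<phi> h \<sigma>)" ..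
  next
    fix \<sigma> assume \<sigma>: "\<sigma> \<in> singular_simplex_set q Y"
    then show "sing_act q Y \<phi> \<one>\<^bsub>G\<^esub> \<sigma> = \<sigma>"
      using singular_simplex_image[of q Y \<sigma>] one
      by (intro extensionalityI[of _ "standard_simplex q"])
        (auto simp: sing_act_def singular_simplex_def)
  qed (use sing_act_simplex[OF Y] in \<open>auto simp: sing_act_def\<close>)
qed

section \<open>Adding a disjoint base point\<close>

lemma openin_plus_space:
  "openin (plus_space X) U \<longleftrightarrow> U \<subseteq> insert None (Some ` topspace X) \<and> openin X {x. Some x \<in> U}"
proof -
  have "{x. Some x \<in> \<Union>\<K>} = \<Union> ((\<lambda>U. {x. Some x \<in> U}) ` \<K>)" for \<K> :: "'a option set set" by auto
  then have "openin X {x. Some x \<in> \<Union>\<K>}" if "\<forall>K\<in>\<K>. openin X {x. Some x \<in> K}" for \<K>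
    using that by (auto intro!: openin_Union)
  moreover have "openin X {x. Some x \<in> S \<inter> T}"
    if "openin X {x. Some x \<in> S}" "openin X {x. Some x \<in> T}" for S T
    using openin_Int[OF that] by (simp add: Collect_conj_eq)
  ultimately have "istopology (\<lambda>U. U \<subseteq> insert None (Some ` topspace X) \<and> openin X {x. Some x \<in> U})"
    unfolding istopology_def by (intro conjI allI impI) (blast | simp)+
  then show ?thesis unfolding plus_space_def by (simp add: topology_inverse')
qed

lemma topspace_plus_space [simp]: "topspace (plus_space X) = insert None (Some ` topspace X)"
proof
  show "topspace (plus_space X) \<subseteq> insert None (Some ` topspace X)"
    using openin_topspace[of "plus_space X"] unfolding openin_plus_space by blast
  have "{x. x \<in> topspace X} = topspace X" by simp
  then have "openin (plus_space X) (insert None (Some ` topspace X))"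
    unfolding openin_plus_space by (auto simp: image_iff)
  then show "insert None (Some ` topspace X) \<subseteq> topspace (plus_space X)"
    by (rule openin_subset)
qed

lemma continuous_map_Some: "continuous_map X (plus_space X) Some"
  by (auto simp: continuous_map_def openin_plus_space Collect_conj_eq openin_Int)

text \<open>The added point is isolated: \<open>{None}\<close> and its complement are both open.
  Applied to the image of a simplex.\<close>

lemma connectedin_plus_space:
  assumes "connectedin (plus_space X) C" "None \<in> C"
  shows "C = {None}"
proof -
  have "openin (plus_space X) {None}" "openin (plus_space X) (Some ` topspace X)"
    by (auto simp: openin_plus_space image_iff)
  moreover have sub: "C \<subseteq> {None} \<union> Some ` topspace X"
    using connectedin_subset_topspace[OF assms(1)] by simp
  ultimately have "{None} \<inter> C = {} \<or> Some ` topspace X \<inter> C = {}"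
    using assms(1) unfolding connectedin by blast
  then have "Some ` topspace X \<inter> C = {}" using assms(2) by auto
  have "y = None" if y: "y \<in> C" for y
  proof (rule ccontr)
    assume "y \<noteq> None"
    then have "y \<in> Some ` topspace X" using sub y by auto
    then show False using \<open>Some ` topspace X \<inter> C = {}\<close> y by blast
  qed
  then show ?thesis using assms(2) by auto
qed

lemma plus_space_G_space:
  assumes X: "G_space G X \<phi>"
  shows "G_space G (plus_space X) (plus_act X \<phi>)"
proof -
  have act: "group_action G (topspace X) \<phi>" and cont: "\<And>g. g \<in> carrier G \<Longrightarrow> continuous_map X X (\<phi> g)"
    using X by (auto simp: G_space_def)
  have G: "group G" using group_action.group_hom[OF act] group_hom.axioms(1) by blast
  have closed: "\<phi> g x \<in> topspace X" if "g \<in> carrier G" "x \<in> topspace X" for g x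
    using group_action.element_image[OF act] that by blast
  have one: "\<phi> \<one>\<^bsub>G\<^esub> y = y" if "y \<in> topspace X" for y
    using group_action.id_eq_one[OF act] that by (metis restrict_apply')
  have "group_action G (topspace (plus_space X)) (plus_act X \<phi>)"
  proof (rule group_actionI[OF G])
    fix g h x assume "g \<in> carrier G" "h \<in> carrier G" "x \<in> topspace (plus_space X)"
    then show "plus_act X \<phi> (g \<otimes>\<^bsub>G\<^esub> h) x = plus_act X \<phi> g (plus_act X \<phi> h x)"
      using closed group_action.composition_rule[OF act] by (auto simp: plus_act_def)
  qed (use closed one in \<open>auto simp: plus_act_def\<close>)
  moreover have "continuous_map (plus_space X) (plus_space X) (plus_act X \<phi> g)" if g: "g \<in> carrier G" for g
    unfolding continuous_map_def
  proof (intro conjI allI impI)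
    show "plus_act X \<phi> g \<in> topspace (plus_space X) \<rightarrow> topspace (plus_space X)"
      using closed[OF g] by (auto simp: plus_act_def)
    fix U assume U: "openin (plus_space X) U"
    have "{x. Some x \<in> {y \<in> topspace (plus_space X). plus_act X \<phi> g y \<in> U}}
        = {x \<in> topspace X. \<phi> g x \<in> {x. Some x \<in> U}}"
      by (auto simp: plus_act_def)
    moreover have "openin X {x \<in> topspace X. \<phi> g x \<in> {x. Some x \<in> U}}"
      by (rule openin_continuous_map_preimage[OF cont[OF g]]) (use U in \<open>simp add: openin_plus_space\<close>)
    ultimately show "openin (plus_space X) {y \<in> topspace (plus_space X). plus_act X \<phi> g y \<in> U}"
      unfolding openin_plus_space by auto
  qed
  ultimately show ?thesis by (simp add: G_space_def)
qed

section \<open>Homology in degree 0\<close>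

locale plus_chains = coeff_sys G R M
  for G :: "('g, 'c) monoid_scheme" (structure)
    and R :: "('r, 'p) ring_scheme" and M :: "('g, 'r, 'm) coeff" +
  fixes X :: "'x topology" and \<phi> :: "'g \<Rightarrow> 'x \<Rightarrow> 'x"
  assumes G_space_X: "G_space G X \<phi>"
begin

abbreviation P :: "'x option topology" where "P \<equiv> plus_space X"
abbreviation act :: "nat \<Rightarrow> 'g \<Rightarrow> ((nat \<Rightarrow> real) \<Rightarrow> 'x option) \<Rightarrow> (nat \<Rightarrow> real) \<Rightarrow> 'x option"
  where "act q \<equiv> sing_act q P (plus_act X \<phi>)"
abbreviation pt :: "'x \<Rightarrow> (nat \<Rightarrow> real) \<Rightarrow> 'x option" where "pt x \<equiv> const_simplex 0 (Some x)"
abbreviation boundary where "boundary \<equiv> differential G R M P (plus_act X \<phi>) None (Suc 0)"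

lemmas G_space_P = plus_space_G_space[OF G_space_X]

lemma pointed_gset_simplices:
  "pointed_gset G R M (singular_simplex_set q P) (act q) (const_simplex q None)"
proof (intro pointed_gset.intro coeff_sys_axioms pointed_gset_axioms.intro)
  show "group_action G (singular_simplex_set q P) (act q)" by (rule sing_act_action[OF G_space_P])
  show "const_simplex q None \<in> singular_simplex_set q P"
    by (simp add: singular_simplex_const)
  show "act q g (const_simplex q None) = const_simplex q None" for g
    by (simp add: sing_act_const) (simp add: plus_act_def)
qed

sublocale S0: pointed_gset G R M "singular_simplex_set 0 P" "act 0" "const_simplex 0 None"
  by (rule pointed_gset_simplices)

sublocale S1: pointed_gset G R M "singular_simplex_set (Suc 0) P" "act (Suc 0)" "const_simplex (Suc 0) None"
  by (rule pointed_gset_simplices)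

lemma chains_eq:
  "chains G M P (plus_act X \<phi>) None 0 = S0.FG" "chains G M P (plus_act X \<phi>) None (Suc 0) = S1.FG"
  by (simp_all add: chains_def)

lemma pt_simplex: "x \<in> topspace X \<Longrightarrow> pt x \<in> singular_simplex_set 0 P"
  by (simp add: singular_simplex_const)

lemma simplex_0_cases:
  assumes "\<sigma> \<in> singular_simplex_set 0 P" "\<sigma> \<noteq> const_simplex 0 None"
  obtains x where "x \<in> topspace X" "\<sigma> = pt x"
  using assms by (auto simp: singular_simplex_0_iff)

lemma st_pt: "x \<in> topspace X \<Longrightarrow> S0.st (pt x) = stabilizer G \<phi> x"
  by (auto simp: stabilizer_def sing_act_const plus_act_def)

section \<open>Faces of edges and the boundary map\<close>

lemma face_simplex:
  assumes "\<sigma> \<in> singular_simplex_set (Suc 0) P" "i \<le> Suc 0"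
  shows "singular_face (Suc 0) i \<sigma> \<in> singular_simplex_set 0 P"
  using singular_simplex_singular_face[of "Suc 0" P \<sigma> i] assms by simp

lemma face_act:
  assumes "\<sigma> \<in> singular_simplex_set (Suc 0) P" "i \<le> Suc 0"
  shows "singular_face (Suc 0) i (act (Suc 0) g \<sigma>) = act 0 g (singular_face (Suc 0) i \<sigma>)"
proof -
  have v: "(\<lambda>j. if j = k then 1 else 0) \<in> standard_simplex (Suc 0)" if "k \<le> Suc 0" for k :: nat
    using that by simp
  have "\<sigma> (\<lambda>j. if j = k then 1 else 0) \<in> topspace P" if "k \<le> Suc 0" for k
    using assms(1) singular_simplex_image[OF _ v[OF that]] by blast
  then show ?thesis
    using assms v[of 0] v[of 1]
    by (cases i) (auto simp: singular_face_1 sing_act_const sing_act_def[of "Suc 0"] simp del: topspace_plus_space)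
qed

lemma face_base: "i \<le> Suc 0 \<Longrightarrow> singular_face (Suc 0) i (const_simplex (Suc 0) None) = const_simplex 0 None"
  by (cases i) (auto simp: singular_face_1 const_simplex_def)

text \<open>The image of the edge is connected and contains the isolated base point. Thus an edge
  other than the base simplex has no face at the base point; otherwise its boundary could have
  nonzero augmentation.\<close>

lemma face_eq_base:
  assumes \<sigma>: "\<sigma> \<in> singular_simplex_set (Suc 0) P" and i: "i \<le> Suc 0"
    and face: "singular_face (Suc 0) i \<sigma> = const_simplex 0 None"
  shows "\<sigma> = const_simplex (Suc 0) None"
proof -
  have c: "continuous_map (subtopology (powertop_real UNIV) (standard_simplex (Suc 0))) P \<sigma>"
    and e: "\<sigma> \<in> extensional (standard_simplex (Suc 0))"
    using \<sigma> by (auto simp: singular_simplex_def)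
  obtain k where k: "k \<le> Suc 0" "\<sigma> (\<lambda>j. if j = k then 1 else 0) = None"
    using face i by (cases i) (auto simp: singular_face_1)
  have "connectedin (subtopology (powertop_real UNIV) (standard_simplex (Suc 0))) (standard_simplex (Suc 0))"
    using connectedin_standard_simplex by (simp add: connectedin_subtopology)
  then have "connectedin P (\<sigma> ` standard_simplex (Suc 0))"
    by (rule connectedin_continuous_map_image[OF c])
  moreover have "None \<in> \<sigma> ` standard_simplex (Suc 0)"
    using k by (metis basis_in_standard_simplex imageI)
  ultimately have "\<sigma> ` standard_simplex (Suc 0) = {None}" by (rule connectedin_plus_space)
  then show ?thesis
    using e by (intro extensionalityI[of _ "standard_simplex (Suc 0)"]) (auto simp: const_simplex_def)
qed

abbreviation face_map where "face_map i \<equiv> FG_map G R M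
  (singular_simplex_set (Suc 0) P) (act (Suc 0)) (const_simplex (Suc 0) None)
  (singular_simplex_set 0 P) (act 0) (const_simplex 0 None) (singular_face (Suc 0) i)"

lemma face_map_lin: "i \<le> Suc 0 \<Longrightarrow> face_map i \<in> lin_maps R S1.FG S0.FG"
  by (rule FG_map_spec(1)[OF S1.pointed_gset_axioms S0.pointed_gset_axioms])
    (use face_simplex face_act face_base in auto)

lemma face_map_gamma:
  assumes i: "i \<le> Suc 0" and \<sigma>: "\<sigma> \<in> singular_simplex_set (Suc 0) P" and l: "l \<in> carrier (S1.V \<sigma>)"
  shows "face_map i (S1.\<gamma> \<sigma> l) = S0.\<gamma> (singular_face (Suc 0) i \<sigma>)
    (mor_by (S1.st \<sigma>) (S0.st (singular_face (Suc 0) i \<sigma>)) \<one> l)"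
  by (rule FG_map_spec(2)[OF S1.pointed_gset_axioms S0.pointed_gset_axioms _ _ _ \<sigma> l])
    (use face_simplex face_act face_base i in auto)

lemma boundary_eq:
  assumes c: "c \<in> carrier S1.FG"
  shows "boundary c = face_map 0 c \<ominus>\<^bsub>S0.FG\<^esub> face_map (Suc 0) c"
proof -
  interpret C0: Module.module R S0.FG by (rule S0.FG_module)
  have f: "face_map 0 c \<in> carrier S0.FG" "face_map (Suc 0) c \<in> carrier S0.FG"
    using lin_maps_closed[OF face_map_lin c] by auto
  have "{..Suc 0} = {0, Suc 0}" by auto
  then have "boundary c = (\<Oplus>\<^bsub>S0.FG\<^esub> i\<in>{0, Suc 0}. (\<ominus>\<^bsub>R\<^esub> \<one>\<^bsub>R\<^esub>) [^]\<^bsub>R\<^esub> i \<odot>\<^bsub>S0.FG\<^esub> face_map i c)"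
    by (simp add: differential_def chains_eq)
  also have "\<dots> = face_map 0 c \<oplus>\<^bsub>S0.FG\<^esub> (\<ominus>\<^bsub>R\<^esub> \<one>\<^bsub>R\<^esub>) \<odot>\<^bsub>S0.FG\<^esub> face_map (Suc 0) c"
    using f by (subst C0.finsum_insert) auto
  also have "\<dots> = face_map 0 c \<ominus>\<^bsub>S0.FG\<^esub> face_map (Suc 0) c"
    using f by (simp add: C0.smult_l_minus a_minus_def)
  finally show ?thesis .
qed

lemma boundary_lin: "boundary \<in> lin_maps R S1.FG S0.FG"
  by (rule lin_maps_cong[OF S1.FG_module lin_maps_sub[OF S1.FG_module S0.FG_module
        face_map_lin[of 0] face_map_lin[of "Suc 0"]] boundary_eq]) auto

definition boundaries where "boundaries = boundary ` carrier S1.FG"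

lemma boundaries_submodule: "submodule boundaries R S0.FG"
  unfolding boundaries_def by (rule lin_maps_image_submodule[OF S1.FG_module S0.FG_module boundary_lin])

lemma homology_0: "homology G R M X \<phi> 0 = quot_module S0.FG boundaries"
proof -
  have "cycles G R M P (plus_act X \<phi>) None 0 = S0.FG"
    by (simp add: cycles_def chains_eq FG_mod_def)
  then show ?thesis by (simp add: homology_def reduced_homology_def chains_eq boundaries_def)
qed

text \<open>The path is a singular 1-simplex with isotropy group \<open>K\<close>, so the difference is the boundary of
  \<open>\<gamma>\<^sub>\<sigma>(l)\<close>, where \<open>\<sigma>\<close> is this simplex.\<close>

lemma gamma_path_homologous:
  assumes x: "x \<in> topspace X"
  defines "K \<equiv> stabilizer G \<phi> x"
  assumes path: "path_component_of (subtopology X (fixed_points X \<phi> K)) y x"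
    and l: "l \<in> carrier (obj M K)"
  shows "S0.\<gamma> (pt x) l \<ominus>\<^bsub>S0.FG\<^esub> S0.\<gamma> (pt y) (mor_by K (stabilizer G \<phi> y) \<one> l) \<in> boundaries"
proof -
  obtain p where "pathin (subtopology X (fixed_points X \<phi> K)) p \<and> p 0 = y \<and> p 1 = x"
    using path unfolding path_component_of_def ..
  then have p: "continuous_map (top_of_set {0..1}) (subtopology X (fixed_points X \<phi> K)) p"
    "p 0 = y" "p 1 = x"
    by (simp_all add: pathin_def)
  have pX: "continuous_map (top_of_set {0..1}) X p"
    and pK: "\<And>t. t \<in> {0..1} \<Longrightarrow> p t \<in> fixed_points X \<phi> K"
    using p(1) by (auto simp: continuous_map_in_subtopology)
  have y: "y \<in> topspace X" using path_component_in_topspace[OF path] by auto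
  \<comment> \<open>The coordinate \<open>v 1\<close> is 0 at vertex 0 and 1 at vertex 1. As the
    path runs from \<open>y\<close> to \<open>x\<close>, face 0 is \<open>pt x\<close> and enters
    the boundary with sign plus.\<close>
  define \<sigma> where "\<sigma> = (\<lambda>v\<in>standard_simplex (Suc 0). Some (p (v 1)))"
  have v01: "v 1 \<in> {0..1}" if "v \<in> standard_simplex (Suc 0)" for v :: "nat \<Rightarrow> real"
    using that by (auto simp: standard_simplex_def)
  have "continuous_map (subtopology (powertop_real UNIV) (standard_simplex (Suc 0)))
      (top_of_set {0..1}) (\<lambda>v. v 1)"
    using v01 continuous_map_from_subtopology[OF continuous_map_product_projection[of "Suc 0" UNIV "\<lambda>_. euclideanreal"]]
    by (auto simp: continuous_map_in_subtopology)
  from continuous_map_compose[OF continuous_map_compose[OF this pX] continuous_map_Some]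
  have "continuous_map (subtopology (powertop_real UNIV) (standard_simplex (Suc 0))) P \<sigma>"
    by (rule continuous_map_eq) (auto simp: \<sigma>_def)
  then have \<sigma>: "\<sigma> \<in> singular_simplex_set (Suc 0) P"
    by (auto simp: singular_simplex_def \<sigma>_def)
  have faces: "singular_face (Suc 0) 0 \<sigma> = pt x" "singular_face (Suc 0) (Suc 0) \<sigma> = pt y"
    using p(2,3) by (simp_all add: singular_face_1 \<sigma>_def)
  have "act (Suc 0) g \<sigma> = \<sigma>" if "g \<in> K" for g
  proof -
    have "plus_act X \<phi> g (\<sigma> v) = \<sigma> v" if v: "v \<in> standard_simplex (Suc 0)" for v
      using pK[OF v01[OF v]] \<open>g \<in> K\<close> v by (auto simp: \<sigma>_def plus_act_def fixed_points_def)
    then show ?thesis using \<sigma>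
      by (intro extensionalityI[of _ "standard_simplex (Suc 0)"]) (auto simp: sing_act_def \<sigma>_def)
  qed
  \<comment> \<open>The path lies in X^K, so \<open>K\<close> fixes the edge. Conversely, whatever
    fixes the edge fixes its end point \<open>x\<close>, so the isotropy group is no larger than
    \<open>K\<close>.\<close>
  moreover have "g \<in> K" if "g \<in> S1.st \<sigma>" for g
  proof -
    have "act 0 g (pt x) = pt x" using face_act[OF \<sigma>, of 0 g] that faces by (simp add: stabilizer_def)
    then have "g \<in> S0.st (pt x)" using that by (simp add: stabilizer_def)
    then show ?thesis using st_pt[OF x] by (simp add: K_def)
  qed
  ultimately have st: "S1.st \<sigma> = K" by (auto simp: K_def stabilizer_def)
  have K: "subgroup K G" using S1.st_subgroup[OF \<sigma>] st by simp
  have mem: "S1.\<gamma> \<sigma> l \<in> carrier S1.FG" using S1.gamma_in[OF \<sigma>] l st by simp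
  have "mor_by K K \<one> l = l" using mor_by_id[OF K _ l] subgroup.one_closed[OF K] by simp
  then have "boundary (S1.\<gamma> \<sigma> l)
      = S0.\<gamma> (pt x) l \<ominus>\<^bsub>S0.FG\<^esub> S0.\<gamma> (pt y) (mor_by K (stabilizer G \<phi> y) \<one> l)"
    using boundary_eq[OF mem] face_map_gamma[OF _ \<sigma>, of 0 l] face_map_gamma[OF _ \<sigma>, of "Suc 0" l]
      faces st l st_pt[OF x] st_pt[OF y] by (simp add: K_def)
  then show ?thesis using mem unfolding boundaries_def by (metis imageI)
qed

lemma stabilizer_fixed: "x \<in> topspace X \<Longrightarrow> x \<in> fixed_points X \<phi> (stabilizer G \<phi> x)"
  by (auto simp: fixed_points_def stabilizer_def)

lemma mor_by_one_lin:
  assumes "subgroup H G" "subgroup K G" "H \<subseteq> K"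
  shows "mor_by H K \<one> \<in> lin_maps R (obj M H) (obj M K)"
proof (rule mor_by_lin[OF assms(1,2) one_closed])
  fix h assume "h \<in> H"
  then show "inv \<one> \<otimes> h \<otimes> \<one> \<in> K" using assms subgroup.mem_carrier by fastforce
qed

lemma stabilizer_subgroup: "x \<in> topspace X \<Longrightarrow> subgroup (stabilizer G \<phi> x) G"
  using S0.st_subgroup[OF pt_simplex] st_pt by simp

section \<open>Homology in degree 0 when all fixed point sets are path connected\<close>

context
  assumes path_connected: "\<And>H x y. subgroup H G \<Longrightarrow> x \<in> fixed_points X \<phi> H \<Longrightarrow>
    y \<in> fixed_points X \<phi> H \<Longrightarrow> path_component_of (subtopology X (fixed_points X \<phi> H)) x y"
begin

lemma homology_0_quotient:
  defines "\<H> \<equiv> {H. subgroup H G \<and> fixed_points X \<phi> H \<noteq> {}}"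
  shows "is_quotient_of R (homology G R M X \<phi> 0) (direct_sum \<H> (obj M))"
proof -
  let ?Q = "quot_module S0.FG boundaries" and ?DS = "direct_sum \<H> (obj M)"
  let ?proj = "\<lambda>u. boundaries +>\<^bsub>S0.FG\<^esub> u"
  note C0 = S0.FG_module and D = boundaries_submodule
  interpret C0: Module.module R S0.FG by (rule C0)
  have Q: "Module.module R ?Q" by (rule quot_module_module[OF C0 D])
  have DS: "Module.module R ?DS"
    by (rule direct_sum_module[OF cring_R]) (auto simp: \<H>_def obj_module)
  have "\<H> \<subseteq> Pow (carrier G)" using subgroup.subset by (auto simp: \<H>_def)
  then have fin: "finite \<H>" using finite_group by (meson finite_Pow_iff finite_subset)
  define c where "c H = (SOME x. x \<in> fixed_points X \<phi> H)" for H
  have c: "c H \<in> fixed_points X \<phi> H" if "H \<in> \<H>" for H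
    using that unfolding c_def \<H>_def by (auto intro: someI)
  then have cX: "c H \<in> topspace X" if "H \<in> \<H>" for H
    using that by (auto simp: fixed_points_def)
  have sub: "H \<subseteq> stabilizer G \<phi> (c H)" if "H \<in> \<H>" for H
    using c[OF that] that subgroup.mem_carrier by (fastforce simp: fixed_points_def stabilizer_def \<H>_def)
  \<comment> \<open>The isotropy group of the chosen point may be larger than \<open>H\<close>, so
    coefficients are first pushed forward along G/H to G/G_c with \<open>c = c H\<close>.\<close>
  define f where "f H l = S0.\<gamma> (pt (c H)) (mor_by H (stabilizer G \<phi> (c H)) \<one> l)" for H l
  have f: "f H \<in> lin_maps R (obj M H) S0.FG" if H: "H \<in> \<H>" for H
  proof -
    have "mor_by H (S0.st (pt (c H))) \<one> \<in> lin_maps R (obj M H) (S0.V (pt (c H)))"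
      using H mor_by_one_lin[OF _ stabilizer_subgroup[OF cX[OF H]] sub[OF H]]
      by (simp add: st_pt[OF cX[OF H]] \<H>_def)
    from lin_maps_comp[OF this S0.gamma_lin[OF pt_simplex[OF cX[OF H]]]]
    show ?thesis unfolding f_def st_pt[OF cX[OF H]] .
  qed
  define \<Psi> where "\<Psi> m = (\<Oplus>\<^bsub>S0.FG\<^esub> H\<in>\<H>. f H (m H))" for m
  have \<Psi>: "\<Psi> \<in> lin_maps R ?DS S0.FG"
    unfolding \<Psi>_def by (rule direct_sum_extend[OF C0 fin f])
  note proj = quot_module_proj[OF C0 D]
  have p\<Psi>: "(\<lambda>m. ?proj (\<Psi> m)) \<in> lin_maps R ?DS ?Q"
    by (rule lin_maps_comp[OF \<Psi> proj])
  let ?im = "(\<lambda>m. ?proj (\<Psi> m)) ` carrier ?DS"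
  \<comment> \<open>It suffices to reach the classes of the generators, because the chains whose
    class is in the image form a submodule.\<close>
  have "submodule {u \<in> carrier S0.FG. ?proj u \<in> ?im} R S0.FG"
    by (rule lin_maps_preimage_submodule[OF C0 Q proj lin_maps_image_submodule[OF DS Q p\<Psi>]])
  moreover have "S0.\<gamma> \<sigma> l \<in> {u \<in> carrier S0.FG. ?proj u \<in> ?im}"
    if \<sigma>: "\<sigma> \<in> singular_simplex_set 0 P" "\<sigma> \<noteq> const_simplex 0 None" and l: "l \<in> carrier (S0.V \<sigma>)" for \<sigma> l
  proof -
    obtain x where x: "x \<in> topspace X" "\<sigma> = pt x" by (rule simplex_0_cases[OF \<sigma>])
    let ?K = "stabilizer G \<phi> x"
    have lK: "l \<in> carrier (obj M ?K)" using l x st_pt by simp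
    have K: "?K \<in> \<H>" using stabilizer_subgroup[OF x(1)] stabilizer_fixed[OF x(1)] by (auto simp: \<H>_def)
    \<comment> \<open>The preimage is concentrated in the summand of the isotropy group of
      \<open>x\<close>; the point chosen for that group is joined to \<open>x\<close> by a path
      inside its fixed point set.\<close>
    define m where "m = (\<lambda>H\<in>\<H>. if ?K = H then l else \<zero>\<^bsub>obj M H\<^esub>)"
    have z: "\<zero>\<^bsub>obj M H\<^esub> \<in> carrier (obj M H)" if "H \<in> \<H>" for H
    proof -
      interpret H: Module.module R "obj M H" using that by (intro obj_module) (simp add: \<H>_def)
      show ?thesis by simp
    qed
    have m: "m \<in> carrier ?DS"
      using lK z fin by (auto simp: m_def direct_sum_def)
    have fz: "f H \<zero>\<^bsub>obj M H\<^esub> = \<zero>\<^bsub>S0.FG\<^esub>" if "H \<in> \<H>" for H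
      using that by (intro lin_maps_zero[OF _ C0 f] obj_module) (simp_all add: \<H>_def)
    have fl: "f ?K l \<in> carrier S0.FG" using lin_maps_closed[OF f[OF K] lK] .
    have "\<Psi> m = (\<Oplus>\<^bsub>S0.FG\<^esub> H\<in>\<H>. if ?K = H then f ?K l else \<zero>\<^bsub>S0.FG\<^esub>)"
      unfolding \<Psi>_def by (rule C0.finsum_cong') (use fl fz in \<open>auto simp: m_def\<close>)
    also have "\<dots> = f ?K l"
      using C0.add.finprod_singleton[OF K fin, of "\<lambda>_. f ?K l"] fl by simp
    finally have \<Psi>m: "\<Psi> m = f ?K l" .
    have \<gamma>: "S0.\<gamma> (pt x) l \<in> carrier S0.FG" using S0.gamma_in \<sigma> l x by blast
    have "path_component_of (subtopology X (fixed_points X \<phi> ?K)) (c ?K) x"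
      by (rule path_connected[OF stabilizer_subgroup[OF x(1)] c[OF K] stabilizer_fixed[OF x(1)]])
    from gamma_path_homologous[OF x(1) this lK]
    have "?proj (S0.\<gamma> (pt x) l) = ?proj (f ?K l)"
      by (subst quot_module_eq_iff[OF C0 D \<gamma> fl]) (simp add: f_def)
    then show ?thesis using \<gamma> m \<Psi>m x(2) by (auto intro: image_eqI[of _ _ m])
  qed
  ultimately have "u \<in> {u \<in> carrier S0.FG. ?proj u \<in> ?im}" if "u \<in> carrier S0.FG" for u
    using S0.FG_generated that by blast
  then have "?im = carrier ?Q"
    using lin_maps_closed[OF p\<Psi>] unfolding quot_module_carrier by blast
  then show ?thesis
    unfolding homology_0 by (rule is_quotient_ofI[OF DS Q p\<Psi>])
qed

text \<open>The kernel of the augmentation \<open>\<epsilon>\<close> is identified with the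
  boundaries, so that the first isomorphism theorem applies. Boundaries lie in the kernel because
  both faces of an edge have the same augmentation; conversely each chain \<open>u\<close> is
  homologous to \<open>\<eta> (\<epsilon> u)\<close>.\<close>

lemma homology_0_fixed_point:
  assumes "fixed_points X \<phi> (carrier G) \<noteq> {}"
  shows "module_iso R (homology G R M X \<phi> 0) (obj M (carrier G))"
proof -
  let ?Q = "quot_module S0.FG boundaries" and ?B = "obj M (carrier G)"
  let ?proj = "\<lambda>u. boundaries +>\<^bsub>S0.FG\<^esub> u"
  let ?b = "const_simplex 0 (None :: 'x option)"
  note C0 = S0.FG_module and D = boundaries_submodule
  interpret C0: Module.module R S0.FG by (rule C0)
  have B: "Module.module R ?B" by (rule obj_module[OF subgroup_self])
  interpret B: Module.module R ?B by (rule B)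
  have Q: "Module.module R ?Q" by (rule quot_module_module[OF C0 D])
  note proj = quot_module_proj[OF C0 D]
  obtain x0 where x0: "x0 \<in> fixed_points X \<phi> (carrier G)" using assms by blast
  have x0X: "x0 \<in> topspace X" and st0: "stabilizer G \<phi> x0 = carrier G"
    using x0 by (auto simp: fixed_points_def stabilizer_def)
  have to_top: "mor_by H (carrier G) \<one> \<in> lin_maps R (obj M H) ?B" if "subgroup H G" for H
    by (rule mor_by_one_lin[OF that subgroup_self subgroup.subset[OF that]])
  \<comment> \<open>Generators at the base simplex are zero, so the prescribed value must be zero
    there, whereas the projection to M(G/G) need not vanish.\<close>
  define lam where "lam \<sigma> = (if \<sigma> = ?b then (\<lambda>l. \<zero>\<^bsub>?B\<^esub>) else mor_by (S0.st \<sigma>) (carrier G) \<one>)" for \<sigma>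
  have "\<exists>L\<in>lin_maps R S0.FG ?B. \<forall>\<sigma>\<in>singular_simplex_set 0 P. \<forall>l\<in>carrier (S0.V \<sigma>).
      L (S0.\<gamma> \<sigma> l) = lam \<sigma> l"
  proof (rule S0.FG_extend[OF B])
    fix \<sigma> assume \<sigma>: "\<sigma> \<in> singular_simplex_set 0 P"
    show "lam \<sigma> \<in> lin_maps R (S0.V \<sigma>) ?B"
      by (cases "\<sigma> = ?b")
        (simp_all add: lam_def to_top[OF S0.st_subgroup[OF \<sigma>]] lin_maps_const_zero[OF B])
    fix g l assume g: "g \<in> carrier G" and l: "l \<in> carrier (S0.V \<sigma>)"
    have eq: "mor_by (S0.st (act 0 g \<sigma>)) (carrier G) \<one> (S0.Rs g \<sigma> l)
        = mor_by (S0.st \<sigma>) (carrier G) (inv g \<otimes> \<one>) l"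
      unfolding R_star_def Let_def
      by (rule mor_by_comp[OF S0.st_subgroup[OF \<sigma>] S0.st_subgroup[OF S0.act_closed[OF g \<sigma>]]
            subgroup_self inv_closed[OF g] one_closed S0.st_conj[OF g \<sigma>] _ l])
        (auto simp: S0.st_iff)
    \<comment> \<open>G/G has a single coset, so every translation into it is the same map. This
      gives the compatibility along orbits.\<close>
    have "orbit_map G (S0.st \<sigma>) (carrier G) (inv g \<otimes> \<one>) = orbit_map G (S0.st \<sigma>) (carrier G) \<one>"
      using g by (intro orbit_map_cong[OF subgroup_self]) auto
    then show "lam (act 0 g \<sigma>) (S0.Rs g \<sigma> l) = lam \<sigma> l"
      using eq S0.act_eq_base[OF g \<sigma>] by (simp add: lam_def)
  qed (simp add: lam_def)
  then obtain \<epsilon> where \<epsilon>: "\<epsilon> \<in> lin_maps R S0.FG ?B"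
    and \<epsilon>\<gamma>: "\<And>\<sigma> l. \<sigma> \<in> singular_simplex_set 0 P \<Longrightarrow> l \<in> carrier (S0.V \<sigma>) \<Longrightarrow> \<epsilon> (S0.\<gamma> \<sigma> l) = lam \<sigma> l"
    by blast
  define \<eta> where "\<eta> l = S0.\<gamma> (pt x0) l" for l
  have V0: "S0.V (pt x0) = ?B" using st_pt[OF x0X] st0 by simp
  have \<eta>: "\<eta> \<in> lin_maps R ?B S0.FG"
    using S0.gamma_lin[OF pt_simplex[OF x0X]] V0 by (simp add: \<eta>_def[abs_def])
  have \<epsilon>\<eta>: "\<epsilon> (\<eta> l) = l" if l: "l \<in> carrier ?B" for l
    using \<epsilon>\<gamma>[OF pt_simplex[OF x0X], of l] V0 l st_pt[OF x0X] st0 mor_by_id[OF subgroup_self one_closed l]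
    by (simp add: \<eta>_def lam_def)
  have boundary_zero: "\<epsilon> (boundary u) = \<zero>\<^bsub>?B\<^esub>" if u: "u \<in> carrier S1.FG" for u
  proof (rule S1.lin_maps_FG_eqI[OF B lin_maps_comp[OF boundary_lin \<epsilon>] lin_maps_const_zero[OF B] _ u])
    fix \<sigma> l assume \<sigma>: "\<sigma> \<in> singular_simplex_set (Suc 0) P" "\<sigma> \<noteq> const_simplex (Suc 0) None"
      and l: "l \<in> carrier (S1.V \<sigma>)"
    have mem: "S1.\<gamma> \<sigma> l \<in> carrier S1.FG" by (rule S1.gamma_in[OF \<sigma>(1) l])
    \<comment> \<open>By functoriality G/G_\<sigma> to G/G_\<tau> to G/G is the canonical projection
      whichever face \<tau> is taken. That \<tau> is not the base simplex ensures that
      \<open>lam\<close> is the projection there.\<close>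
    have face: "\<epsilon> (face_map i (S1.\<gamma> \<sigma> l)) = mor_by (S1.st \<sigma>) (carrier G) \<one> l" if i: "i \<le> Suc 0" for i
    proof -
      let ?\<tau> = "singular_face (Suc 0) i \<sigma>"
      have \<tau>: "?\<tau> \<in> singular_simplex_set 0 P" "?\<tau> \<noteq> ?b"
        using face_simplex[OF \<sigma>(1) i] face_eq_base[OF \<sigma>(1) i] \<sigma>(2) by auto
      have sub: "S1.st \<sigma> \<subseteq> S0.st ?\<tau>"
      proof
        fix g assume "g \<in> S1.st \<sigma>"
        then show "g \<in> S0.st ?\<tau>"
          using face_act[OF \<sigma>(1) i, of g] by (simp add: stabilizer_def)
      qed
      note sg = S1.st_subgroup[OF \<sigma>(1)] S0.st_subgroup[OF \<tau>(1)]
      have m: "mor_by (S1.st \<sigma>) (S0.st ?\<tau>) \<one> l \<in> carrier (S0.V ?\<tau>)"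
        by (rule lin_maps_closed[OF mor_by_one_lin[OF sg sub] l])
      have "\<epsilon> (face_map i (S1.\<gamma> \<sigma> l)) = mor_by (S0.st ?\<tau>) (carrier G) \<one> (mor_by (S1.st \<sigma>) (S0.st ?\<tau>) \<one> l)"
        using face_map_gamma[OF i \<sigma>(1) l] \<epsilon>\<gamma>[OF \<tau>(1) m] \<tau>(2) by (simp add: lam_def)
      also have "\<dots> = mor_by (S1.st \<sigma>) (carrier G) (\<one> \<otimes> \<one>) l"
        by (rule mor_by_comp[OF sg subgroup_self one_closed one_closed _ _ l])
          (use sub in \<open>auto simp: S0.st_iff S1.st_iff\<close>)
      finally show ?thesis by simp
    qed
    have "\<epsilon> (boundary (S1.\<gamma> \<sigma> l))
        = \<epsilon> (face_map 0 (S1.\<gamma> \<sigma> l)) \<ominus>\<^bsub>?B\<^esub> \<epsilon> (face_map (Suc 0) (S1.\<gamma> \<sigma> l))"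
      unfolding boundary_eq[OF mem]
      by (rule lin_maps_diff[OF C0 B \<epsilon>]) (use lin_maps_closed[OF face_map_lin mem] in auto)
    also have "\<dots> = \<zero>\<^bsub>?B\<^esub>"
      using face[of 0] face[of "Suc 0"] lin_maps_closed[OF to_top[OF S1.st_subgroup[OF \<sigma>(1)]] l]
      by (simp add: a_minus_def B.r_neg)
    finally show "\<epsilon> (boundary (S1.\<gamma> \<sigma> l)) = \<zero>\<^bsub>?B\<^esub>" .
  qed
  have homologous: "?proj u = ?proj (\<eta> (\<epsilon> u))" if u: "u \<in> carrier S0.FG" for u
  proof (rule S0.lin_maps_FG_eqI[OF Q proj lin_maps_comp[OF \<epsilon> lin_maps_comp[OF \<eta> proj]] _ u])
    fix \<sigma> l assume \<sigma>: "\<sigma> \<in> singular_simplex_set 0 P" "\<sigma> \<noteq> ?b" and l: "l \<in> carrier (S0.V \<sigma>)"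
    obtain x where x: "x \<in> topspace X" "\<sigma> = pt x" by (rule simplex_0_cases[OF \<sigma>])
    let ?K = "stabilizer G \<phi> x"
    have lK: "l \<in> carrier (obj M ?K)" using l x st_pt by simp
    have K: "subgroup ?K G" by (rule stabilizer_subgroup[OF x(1)])
    have "\<epsilon> (S0.\<gamma> \<sigma> l) = mor_by ?K (carrier G) \<one> l"
      using \<epsilon>\<gamma>[OF \<sigma>(1) l] \<sigma>(2) x st_pt by (simp add: lam_def)
    \<comment> \<open>A point fixed by all of \<open>G\<close> lies in the fixed point set of every
      isotropy group, so one point serves as the end of all the paths.\<close>
    moreover have "x0 \<in> fixed_points X \<phi> ?K"
      using x0 by (auto simp: fixed_points_def stabilizer_def)
    then have "path_component_of (subtopology X (fixed_points X \<phi> ?K)) x0 x"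
      using path_connected[OF K _ stabilizer_fixed[OF x(1)]] by blast
    from gamma_path_homologous[OF x(1) this lK]
    have "S0.\<gamma> \<sigma> l \<ominus>\<^bsub>S0.FG\<^esub> \<eta> (mor_by ?K (carrier G) \<one> l) \<in> boundaries"
      by (simp add: \<eta>_def st0 x(2))
    ultimately show "?proj (S0.\<gamma> \<sigma> l) = ?proj (\<eta> (\<epsilon> (S0.\<gamma> \<sigma> l)))"
      using S0.gamma_in[OF \<sigma>(1) l] lin_maps_closed[OF \<eta> lin_maps_closed[OF to_top[OF K] lK]]
      by (subst quot_module_eq_iff[OF C0 D]) auto
  qed
  have "{u \<in> carrier S0.FG. \<epsilon> u = \<zero>\<^bsub>?B\<^esub>} = boundaries"
  proof (intro equalityI subsetI)
    fix u assume "u \<in> {u \<in> carrier S0.FG. \<epsilon> u = \<zero>\<^bsub>?B\<^esub>}"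
    then have u: "u \<in> carrier S0.FG" "\<epsilon> u = \<zero>\<^bsub>?B\<^esub>" by auto
    then have "?proj u = ?proj \<zero>\<^bsub>S0.FG\<^esub>"
      using homologous[OF u(1)] lin_maps_zero[OF B C0 \<eta>] by simp
    then have "u \<ominus>\<^bsub>S0.FG\<^esub> \<zero>\<^bsub>S0.FG\<^esub> \<in> boundaries"
      using quot_module_eq_iff[OF C0 D u(1) C0.zero_closed] by simp
    moreover have "\<ominus>\<^bsub>S0.FG\<^esub> \<zero>\<^bsub>S0.FG\<^esub> = \<zero>\<^bsub>S0.FG\<^esub>"
      using C0.M.l_neg[OF C0.M.zero_closed] C0.M.r_zero[OF C0.M.a_inv_closed[OF C0.M.zero_closed]]
      by simp
    ultimately show "u \<in> boundaries" using u(1) by (simp add: a_minus_def)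
  next
    fix u assume "u \<in> boundaries"
    then show "u \<in> {u \<in> carrier S0.FG. \<epsilon> u = \<zero>\<^bsub>?B\<^esub>}"
      using boundary_zero lin_maps_closed[OF boundary_lin] by (auto simp: boundaries_def)
  qed
  moreover have "\<epsilon> ` carrier S0.FG = carrier ?B"
  proof
    show "\<epsilon> ` carrier S0.FG \<subseteq> carrier ?B" using lin_maps_closed[OF \<epsilon>] by auto
    show "carrier ?B \<subseteq> \<epsilon> ` carrier S0.FG"
      using \<epsilon>\<eta> lin_maps_closed[OF \<eta>] by (metis imageI subsetI)
  qed
  ultimately show ?thesis
    unfolding homology_0 using first_isomorphism[OF C0 B \<epsilon>] by simp
qed

end

end

theorem proposition5p15:
  fixes G :: "('g, 'c) monoid_scheme"
    and R :: "('r, 'p) ring_scheme"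
    and M :: "('g, 'r, 'm) coeff"
    and X :: "'x topology" and \<phi> :: "'g \<Rightarrow> 'x \<Rightarrow> 'x"
    and Y :: "'y topology" and \<theta> :: "'g \<Rightarrow> 'y \<Rightarrow> 'y"
  assumes "group G" and "finite (carrier G)"
    and "cring R" and "coefficient_system G R M"
    and "G_space G X \<phi>" and "k_space_via TYPE('z) X"
    and "G_CW_complex G Y \<theta>" and "G_homotopy_equivalent G X \<phi> Y \<theta>"
    and "\<And>H. subgroup H G \<Longrightarrow> connectedin X (fixed_points X \<phi> H)"
  shows "is_quotient_of R (homology G R M X \<phi> 0)
           (direct_sum {H. subgroup H G \<and> fixed_points X \<phi> H \<noteq> {}} (obj M)) \<and>
         (fixed_points X \<phi> (carrier G) \<noteq> {} \<longrightarrow>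
           module_iso R (homology G R M X \<phi> 0) (obj M (carrier G)))"
proof -
  interpret plus_chains G R M X \<phi>
    using assms(1-5)
    by (simp add: plus_chains_def plus_chains_axioms_def coeff_sys_def coeff_sys_axioms_def)
  \<comment> \<open>The cell structure and the connectedness hypothesis are used up here; the
    homology computation needs just paths in the fixed point sets.\<close>
  have "path_component_of (subtopology X (fixed_points X \<phi> H)) x y"
    if "subgroup H G" "x \<in> fixed_points X \<phi> H" "y \<in> fixed_points X \<phi> H" for H x y
    using fixed_points_path_connected[OF assms(1,2) that(1) assms(7,8) assms(9)[OF that(1)] that(2,3)] .
  then show ?thesis
    using homology_0_quotient homology_0_fixed_point by blast
qed

end
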